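(* For every natural number $n$ there exists a constant $C$ with the following property: whenever $M$ is a subgroup of $\mathrm{GL}_n(\mathbb{C})$ containing a normal subgroup $\Gamma$ of finite index with $\Gamma \cong \mathbb{Z}$, and $c_M$ denotes the smallest index of an abelian subgroup of the finite group $M/\Gamma$, we have $c_M < C$. *)

theory Defs
  imports "HOL-Analysis.Analysis" "HOL-Algebra.Algebra"
begin

definition GL :: "(complex^'n^'n) monoid" where
  "GL = \<lparr>carrier = {A. invertible A}, monoid.mult = (\<lambda>A B. A ** B), one = mat 1\<rparr>"

definition min_abelian_index :: "('a, 'b) monoid_scheme \<Rightarrow> nat" where
  "min_abelian_index G =
     (LEAST k. \<exists>A. subgroup A G \<and> comm_group (G\<lparr>carrier := A\<rparr>) \<and> card (rcosets\<^bsub>G\<^esub> A) = k)"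

end

theory Submission
  imports Defs "HOL-Computational_Algebra.Fundamental_Theorem_Algebra"
begin

text \<open>
  Let \<open>z\<close> generate \<open>\<Gamma>\<close>. The centralizer \<open>H\<close> of \<open>z\<close> has index at most 2 in \<open>M\<close>, and \<open>\<Gamma>\<close> is central
  of finite index \<open>k\<close> in \<open>H\<close>; the transfer is a homomorphism \<open>V : H \<rightarrow> \<int>\<close> with \<open>V z = k\<close>.
  The invertible matrix \<open>z\<close> has a \<open>k\<close>-th root \<open>D\<close> that is a polynomial in \<open>z\<close> and hence commutes
  with \<open>H\<close>. Then \<open>\<rho> x = x D\<^bsup>-V x\<^esup>\<close> is a homomorphism from \<open>H\<close> to \<open>GL\<close> that kills \<open>\<Gamma>\<close>, so it has
  finite image \<open>R\<close>, and \<open>x\<close>, \<open>y\<close> commute as soon as \<open>\<rho> x\<close>, \<open>\<rho> y\<close> do.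

  It remains to treat the finite group \<open>R\<close> as in Jordan's theorem. For an \<open>R\<close>-invariant norm, taking
  commutators with an element near 1 contracts towards 1, and a commutator of small elements that
  commutes with one of them is trivial because all its powers are small; hence the elements at
  distance at most 1/4 from 1 commute pairwise. A volume argument shows that there are at most
  \<open>9\<^sup>d\<close> elements of \<open>R\<close> with pairwise distances above 1/4, where \<open>d = 2n\<^sup>2\<close>.
\<close>

subsection \<open>Matrices and the groups they form\<close>

lemma group_GL: "group (GL :: (complex^'n^'n) monoid)"
proof (rule groupI)
  fix x :: "complex^'n^'n" assume "x \<in> carrier GL"
  then obtain y where "x ** y = mat 1" "y ** x = mat 1"
    by (auto simp: GL_def invertible_def)
  then show "\<exists>y\<in>carrier GL. y \<otimes>\<^bsub>GL\<^esub> x = \<one>\<^bsub>GL\<^esub>"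
    by (auto simp: GL_def invertible_def)
qed (auto simp: GL_def invertible_mult matrix_mul_assoc intro: exI[of _ "mat 1"] simp: invertible_def[of "mat 1"])

interpretation GL: group GL
  by (rule group_GL)

lemma mult_GL: "x \<otimes>\<^bsub>GL\<^esub> y = x ** y"
  and one_GL: "\<one>\<^bsub>GL\<^esub> = mat 1"
  and carrier_GL: "carrier GL = {A. invertible A}"
  by (simp_all add: GL_def)

lemma matrix_vector_mult_minus_left: "(- A) *v x = - (A *v (x :: complex^'n))"
  using matrix_vector_mult_diff_rdistrib[of 0 A x] by simp

lemma matrix_vector_mult_minus_right: "A *v (- x) = - (A *v (x :: complex^'n))"
  using matrix_vector_mult_diff_distrib[of A 0 x] by simp

lemma scaleR_matrix_vector_mult: "(c *\<^sub>R A) *v x = c *\<^sub>R (A *v (x :: complex^'n))"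
  by (simp add: vec_eq_iff matrix_vector_mult_def scaleR_right.sum)

lemma bounded_linear_matrix_vector_mult_left:
  "bounded_linear (\<lambda>A::complex^'n^'n. A *v x)"
  by (intro linear_conv_bounded_linear[THEN iffD1] linearI)
    (simp_all add: matrix_vector_mult_add_rdistrib scaleR_matrix_vector_mult)

primrec mpow :: "complex^'n^'n \<Rightarrow> nat \<Rightarrow> complex^'n^'n" where
  "mpow A 0 = mat 1"
| "mpow A (Suc k) = A ** mpow A k"

lemma mpow_add: "mpow A (i + j) = mpow A i ** mpow A j"
  by (induction i) (simp_all add: matrix_mul_assoc)

lemma mpow_commute: "A ** B = B ** A \<Longrightarrow> mpow A k ** B = B ** mpow A k"
  by (induction k) (simp_all, metis matrix_mul_assoc)

lemma matrix_mul_diff_left: "(A - B) ** D = A ** D - B ** (D :: complex^'n^'n)"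
  by (simp add: matrix_matrix_mult_def vec_eq_iff left_diff_distrib sum_subtractf)

lemma matrix_mul_diff_right: "D ** (A - B) = D ** A - D ** (B :: complex^'n^'n)"
  by (simp add: matrix_matrix_mult_def vec_eq_iff right_diff_distrib sum_subtractf)

subsection \<open>Elements of a finite linear group near the identity\<close>

text \<open>Packing: \<open>U\<close> acts as the unit ball of a norm, and the separation says that
  the points of \<open>T\<close> are more than 1/4 apart. Balls of radius 1/8 around them are
  therefore disjoint and lie in the ball of radius 9/8; comparing volumes leaves a factor 9 per
  dimension.\<close>

lemma separated_subset_card_le:
  fixes U :: "'a::euclidean_space set"
  assumes U: "convex U" "compact U" "interior U \<noteq> {}"
    and sym: "\<And>x. x \<in> U \<Longrightarrow> - x \<in> U"
    and T: "finite T" "T \<subseteq> U"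
    and sep: "\<And>x y. x \<in> T \<Longrightarrow> y \<in> T \<Longrightarrow> x \<noteq> y \<Longrightarrow> 4 *\<^sub>R (x - y) \<notin> U"
  shows "card T \<le> 9 ^ DIM('a)"
proof -
  let ?B = "\<lambda>t. (\<lambda>x. (1/8) *\<^sub>R x + t) ` U"
  let ?m = "measure lebesgue U"
  have aff: "(\<lambda>x. c *\<^sub>R x + t) ` U \<in> lmeasurable" for c :: real and t
    by (intro lmeasurable_compact compact_continuous_image continuous_intros U)
  have "\<not> negligible U"
    using U(3) interior_subset negligible_subset open_interior open_not_negligible by metis
  then have "?m \<noteq> 0"
    using negligible_iff_measure lmeasurable_compact[OF U(2)] by blast
  then have pos: "?m > 0"
    by (simp add: zero_less_measure_iff)
  have disj: "disjnt (?B x) (?B y)" if "x \<in> T" "y \<in> T" "x \<noteq> y" for x y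
  proof (rule ccontr)
    assume "\<not> disjnt (?B x) (?B y)"
    then obtain u v where uv: "u \<in> U" "v \<in> U" "(1/8) *\<^sub>R u + x = (1/8) *\<^sub>R v + y"
      by (auto simp: disjnt_def)
    then have "x - y = (1/8) *\<^sub>R (v - u)"
      by (simp add: algebra_simps)
    \<comment> \<open>A common point of two copies would make this vector the midpoint of
      \<open>v\<close> and \<open>- u\<close>.\<close>
    then have "4 *\<^sub>R (x - y) = (1/2) *\<^sub>R v + (1/2) *\<^sub>R (- u)"
      by (simp only: scaleR_scaleR) (simp add: scaleR_right_diff_distrib)
    also have "\<dots> \<in> U"
      using uv sym by (intro convexD[OF U(1)]) auto
    finally show False
      using sep that by blast
  qed
  have sub: "(\<Union>t\<in>T. ?B t) \<subseteq> (\<lambda>x. (9/8) *\<^sub>R x + 0) ` U"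
  proof clarify
    fix t u assume tu: "t \<in> T" "u \<in> U"
    have "(8/9) *\<^sub>R t + (1/9) *\<^sub>R u \<in> U"
      using tu T(2) by (intro convexD[OF U(1)]) auto
    moreover have "(1/8) *\<^sub>R u + t = (9/8) *\<^sub>R ((8/9) *\<^sub>R t + (1/9) *\<^sub>R u) + 0"
      by (simp add: algebra_simps)
    ultimately show "(1/8) *\<^sub>R u + t \<in> (\<lambda>x. (9/8) *\<^sub>R x + 0) ` U"
      by blast
  qed
  have "real (card T) * ((1/8) ^ DIM('a) * ?m) = (\<Sum>t\<in>T. measure lebesgue (?B t))"
    by (simp add: measure_lebesgue_affine)
  also have "\<dots> = measure lebesgue (\<Union>t\<in>T. ?B t)"
    by (rule measure_UNION'[symmetric]) (use T aff disj in \<open>auto simp: pairwise_def\<close>)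
  also have "\<dots> \<le> measure lebesgue ((\<lambda>x. (9/8) *\<^sub>R x + 0) ` U)"
    by (intro measure_mono_fmeasurable sub aff sets.finite_UN T fmeasurableD)
  also have "\<dots> = (9/8) ^ DIM('a) * ?m"
    by (subst measure_lebesgue_affine) simp
  finally have "real (card T) * (1/8) ^ DIM('a) \<le> (9/8) ^ DIM('a)"
    using pos by (simp add: mult.assoc[symmetric] del: mult.assoc)
  then have "real (card T) \<le> 9 ^ DIM('a)"
    by (simp add: power_divide divide_le_cancel)
  then show ?thesis
    by (metis of_nat_le_iff of_nat_numeral of_nat_power)
qed

section \<open>The averaged norm of a finite linear group and its operator bounds\<close>

definition orbit_norm :: "(complex^'n^'n) set \<Rightarrow> complex^'n \<Rightarrow> real"
  where "orbit_norm R x = (\<Sum>g\<in>R. norm (g *v x))"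

text \<open>The operator norm induced by \<open>orbit_norm R\<close>, encoded through its upper
  bounds so that no supremum has to be formed.\<close>

definition op_bound :: "(complex^'n^'n) set \<Rightarrow> complex^'n^'n \<Rightarrow> real \<Rightarrow> bool"
  where "op_bound R A c \<longleftrightarrow> (\<forall>x. orbit_norm R (A *v x) \<le> c * orbit_norm R x)"

lemma orbit_norm_nonneg: "orbit_norm R x \<ge> 0"
  by (simp add: orbit_norm_def sum_nonneg)

lemma orbit_norm_add: "orbit_norm R (x + y) \<le> orbit_norm R x + orbit_norm R y"
  unfolding orbit_norm_def sum.distrib[symmetric]
  by (intro sum_mono) (simp add: matrix_vector_right_distrib norm_triangle_ineq)

lemma orbit_norm_minus: "orbit_norm R (- x) = orbit_norm R x"
  by (simp add: orbit_norm_def matrix_vector_mult_minus_right)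

lemma orbit_norm_scaleR: "orbit_norm R (c *\<^sub>R x) = \<bar>c\<bar> * orbit_norm R x"
  by (simp add: orbit_norm_def linear_scale[OF matrix_vector_mul_linear] sum_distrib_left)

lemma op_bound_mono: "op_bound R A c \<Longrightarrow> c \<le> d \<Longrightarrow> op_bound R A d"
  unfolding op_bound_def by (meson mult_right_mono order_trans orbit_norm_nonneg)

lemma op_bound_add:
  assumes "op_bound R A c" "op_bound R B d"
  shows "op_bound R (A + B) (c + d)"
  unfolding op_bound_def
proof
  fix x
  have "orbit_norm R ((A + B) *v x) \<le> orbit_norm R (A *v x) + orbit_norm R (B *v x)"
    by (simp add: matrix_vector_mult_add_rdistrib orbit_norm_add)
  also have "\<dots> \<le> c * orbit_norm R x + d * orbit_norm R x"
    using assms by (simp add: op_bound_def add_mono)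
  finally show "orbit_norm R ((A + B) *v x) \<le> (c + d) * orbit_norm R x"
    by (simp add: distrib_right)
qed

lemma op_bound_minus: "op_bound R (- A) c \<longleftrightarrow> op_bound R A c"
  by (simp add: op_bound_def matrix_vector_mult_minus_left orbit_norm_minus)

lemma op_bound_diff:
  assumes "op_bound R A c" "op_bound R B d"
  shows "op_bound R (A - B) (c + d)"
  using op_bound_add[of R A c "- B" d] assms by (simp add: op_bound_minus)

lemma op_bound_mult:
  assumes "op_bound R A c" "op_bound R B d" "c \<ge> 0"
  shows "op_bound R (A ** B) (c * d)"
  unfolding op_bound_def
proof
  fix x
  have "orbit_norm R ((A ** B) *v x) \<le> c * orbit_norm R (B *v x)"
    using assms by (simp add: op_bound_def flip: matrix_vector_mul_assoc)
  also have "\<dots> \<le> c * (d * orbit_norm R x)"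
    using assms by (intro mult_left_mono) (auto simp: op_bound_def)
  finally show "orbit_norm R ((A ** B) *v x) \<le> c * d * orbit_norm R x"
    by (simp add: mult.assoc)
qed

lemma op_bound_scaleR:
  assumes "c > 0"
  shows "op_bound R (c *\<^sub>R A) d \<longleftrightarrow> op_bound R A (d / c)"
  using assms by (auto simp: op_bound_def scaleR_matrix_vector_mult orbit_norm_scaleR field_simps)

locale finite_linear_group =
  fixes R :: "(complex^'n^'n) set"
  assumes finite: "finite R" and subgroup: "subgroup R GL"
begin

lemma mult_closed: "g \<in> R \<Longrightarrow> h \<in> R \<Longrightarrow> g ** h \<in> R"
  using subgroup.m_closed[OF subgroup] by (simp add: mult_GL)

lemma one_closed: "mat 1 \<in> R"
  using subgroup.one_closed[OF subgroup] by (simp add: one_GL)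

lemma inverse_obtain:
  assumes "g \<in> R"
  obtains g' where "g' \<in> R" "g ** g' = mat 1" "g' ** g = mat 1"
proof
  have c: "g \<in> carrier GL"
    using assms subgroup.subset[OF subgroup] by blast
  show "inv\<^bsub>GL\<^esub> g \<in> R"
    using subgroup.m_inv_closed[OF subgroup assms] .
  show "g ** inv\<^bsub>GL\<^esub> g = mat 1" "inv\<^bsub>GL\<^esub> g ** g = mat 1"
    using GL.r_inv[OF c] GL.l_inv[OF c] by (simp_all add: mult_GL one_GL)
qed

text \<open>Right multiplication by \<open>h\<close> permutes the summation range \<open>R\<close>.
  Hence multiplying by elements of \<open>R\<close> on either side preserves operator
  bounds.\<close>

lemma orbit_norm_invariant:
  assumes "h \<in> R"
  shows "orbit_norm R (h *v x) = orbit_norm R x"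
proof -
  obtain h' where h': "h' \<in> R" "h ** h' = mat 1" "h' ** h = mat 1"
    using inverse_obtain assms .
  have "(\<Sum>g\<in>R. norm ((g ** h) *v x)) = (\<Sum>g\<in>R. norm (g *v x))"
    by (rule sum.reindex_bij_witness[of _ "\<lambda>g. g ** h'" "\<lambda>g. g ** h"])
      (use h' assms mult_closed in \<open>auto simp: matrix_mul_assoc[symmetric]\<close>)
  then show ?thesis
    by (simp add: orbit_norm_def matrix_vector_mul_assoc)
qed

lemma op_bound_mult_left:
  "h \<in> R \<Longrightarrow> op_bound R (h ** A) c \<longleftrightarrow> op_bound R A c"
  by (simp add: op_bound_def orbit_norm_invariant flip: matrix_vector_mul_assoc)

lemma op_bound_mult_right:
  assumes "h \<in> R"
  shows "op_bound R (A ** h) c \<longleftrightarrow> op_bound R A c"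
proof
  obtain h' where h': "h' \<in> R" "h ** h' = mat 1" "h' ** h = mat 1"
    using inverse_obtain assms .
  have *: "op_bound R (B ** g) c" if "op_bound R B c" "g \<in> R" for B g
    using that orbit_norm_invariant[OF that(2)]
    unfolding op_bound_def matrix_vector_mul_assoc[symmetric] by metis
  show "op_bound R A c \<Longrightarrow> op_bound R (A ** h) c"
    using * assms by blast
  show "op_bound R (A ** h) c \<Longrightarrow> op_bound R A c"
    using *[of "A ** h" h'] h' by (simp add: matrix_mul_assoc[symmetric])
qed

lemma op_bound_group: "h \<in> R \<Longrightarrow> op_bound R h 1"
  by (simp add: op_bound_def orbit_norm_invariant)

lemma norm_le_orbit_norm: "norm x \<le> orbit_norm R x"
  using member_le_sum[of "mat 1" R "\<lambda>g. norm (g *v x)"] one_closed finite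
  by (simp add: orbit_norm_def)

lemma op_bound_le_0:
  assumes "op_bound R A 0"
  shows "A = 0"
  using assms norm_le_orbit_norm order_trans
  by (metis (no_types, lifting) op_bound_def mult_zero_left norm_le_zero_iff matrix_eq matrix_vector_mult_0)

text \<open>Every \<open>g\<close> is a bounded linear map, and the finitely many constants add up.
  With \<open>norm_le_orbit_norm\<close> this makes the two norms equivalent, on which boundedness
  and interior of the unit ball rest.\<close>

lemma orbit_norm_le_norm: "\<exists>C>0. \<forall>x. orbit_norm R x \<le> C * norm x"
proof -
  have "\<exists>K>0. \<forall>x. norm (g *v x) \<le> K * norm x" for g :: "complex^'n^'n"
    using bounded_linear.pos_bounded[OF matrix_vector_mul_bounded_linear[of g]]
    by (metis mult.commute)
  then have "\<exists>K. \<forall>g::complex^'n^'n. K g > 0 \<and> (\<forall>x. norm (g *v x) \<le> K g * norm x)"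
    by (intro choice) blast
  then obtain K where K: "\<And>g::complex^'n^'n. K g > 0" "\<And>(g::complex^'n^'n) x. norm (g *v x) \<le> K g * norm x"
    by blast
  have "orbit_norm R x \<le> (\<Sum>g\<in>R. K g) * norm x" for x
    unfolding orbit_norm_def sum_distrib_right using K by (intro sum_mono) auto
  moreover have "(\<Sum>g\<in>R. K g) > 0"
    using K one_closed finite by (intro sum_pos) auto
  ultimately show ?thesis by blast
qed

section \<open>The operator unit ball as a convex body, and the packing bound\<close>

lemma unit_ball_symmetric: "A \<in> {A. op_bound R A 1} \<Longrightarrow> - A \<in> {A. op_bound R A 1}"
  by (simp add: op_bound_minus)

lemma unit_ball_convex: "convex {A. op_bound R A 1}"
proof (rule convexI)
  fix A B and u v :: real
  assume AB: "A \<in> {A. op_bound R A 1}" "B \<in> {A. op_bound R A 1}" and uv: "0 \<le> u" "0 \<le> v" "u + v = 1"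
  have *: "op_bound R (c *\<^sub>R D) c" if "op_bound R D 1" "c \<ge> 0" for D and c :: real
    using that mult_left_mono[OF _ that(2)]
    by (fastforce simp: op_bound_def scaleR_matrix_vector_mult orbit_norm_scaleR)
  show "u *\<^sub>R A + v *\<^sub>R B \<in> {A. op_bound R A 1}"
    using op_bound_add[OF *[of A u] *[of B v]] AB uv by simp
qed

lemma unit_ball_closed: "closed {A. op_bound R A 1}"
proof -
  have cont: "continuous_on UNIV (\<lambda>A::complex^'n^'n. orbit_norm R (A *v x))" for x
    unfolding orbit_norm_def
    by (intro continuous_intros linear_continuous_on
          bounded_linear_compose[OF matrix_vector_mul_bounded_linear]
          bounded_linear_matrix_vector_mult_left)
  have "{A. op_bound R A 1} = (\<Inter>x. {A. orbit_norm R (A *v x) \<le> orbit_norm R x})"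
    by (auto simp: op_bound_def)
  also have "closed \<dots>"
    by (intro closed_INT ballI closed_Collect_le cont continuous_on_const)
  finally show ?thesis .
qed

lemma unit_ball_compact: "compact {A. op_bound R A 1}"
proof -
  obtain C where C: "C > 0" "\<And>x. orbit_norm R x \<le> C * norm x"
    using orbit_norm_le_norm by blast
  have "norm A \<le> (\<Sum>i\<in>(UNIV::'n set). \<Sum>j\<in>(UNIV::'n set). C)" if "op_bound R A 1" for A
  proof -
    \<comment> \<open>An entry is a coordinate of the image of a basis vector, and \<open>A\<close>
      does not increase orbit norms.\<close>
    have entry: "norm (A $ i $ j) \<le> C" for i j
    proof -
      have "A $ i $ j = (A *v axis j 1) $ i"
        by (simp add: matrix_vector_mult_def axis_def if_distrib[of "(*) _"] sum.delta' cong: if_cong)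
      then have "norm (A $ i $ j) \<le> norm (A *v axis j 1)"
        by (metis component_le_norm_cart Finite_Cartesian_Product.norm_nth_le)
      also have "\<dots> \<le> orbit_norm R (A *v axis j 1)"
        by (rule norm_le_orbit_norm)
      also have "\<dots> \<le> orbit_norm R (axis j 1)"
        using that by (simp add: op_bound_def)
      also have "\<dots> \<le> C * norm (axis j (1::complex) :: complex^'n)"
        by (rule C)
      finally show ?thesis by (simp add: norm_vec_def L2_set_def axis_def if_distrib[of norm] if_distrib[of "\<lambda>x. x\<^sup>2"] sum.delta' cong: if_cong)
    qed
    have "norm A \<le> (\<Sum>i\<in>UNIV. norm (A $ i))"
      by (simp add: norm_vec_def L2_set_le_sum)
    also have "\<dots> \<le> (\<Sum>i\<in>UNIV. \<Sum>j\<in>UNIV. norm (A $ i $ j))"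
      by (intro sum_mono) (simp add: norm_vec_def L2_set_le_sum)
    also have "\<dots> \<le> (\<Sum>i\<in>(UNIV::'n set). \<Sum>j\<in>(UNIV::'n set). C)"
      by (intro sum_mono entry)
    finally show ?thesis .
  qed
  then have "bounded {A. op_bound R A 1}"
    unfolding bounded_iff by blast
  then show ?thesis
    using unit_ball_closed by (simp add: compact_eq_bounded_closed)
qed

lemma unit_ball_interior: "interior {A. op_bound R A 1} \<noteq> {}"
proof -
  obtain C where C: "C > 0" "\<And>x. orbit_norm R x \<le> C * norm x"
    using orbit_norm_le_norm by blast
  have "bilinear ((*v) :: complex^'n^'n \<Rightarrow> complex^'n \<Rightarrow> complex^'n)"
    unfolding bilinear_def
    using bounded_linear_matrix_vector_mult_left bounded_linear.linear by auto
  from bilinear_bounded_pos[OF this] obtain D where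
    D: "D > 0" "\<And>(A::complex^'n^'n) x. norm (A *v x) \<le> D * norm A * norm x"
    by blast
  have "op_bound R A 1" if "norm A < 1 / (C * D)" for A
    unfolding op_bound_def
  proof
    fix x
    have "orbit_norm R (A *v x) \<le> C * (D * norm A * norm x)"
      using C D order_trans mult_left_mono by (metis less_imp_le)
    also have "\<dots> = (C * D * norm A) * norm x" by simp
    also have "\<dots> \<le> 1 * norm x"
      using that C D by (intro mult_right_mono) (auto simp: field_simps)
    also have "\<dots> \<le> orbit_norm R x" using norm_le_orbit_norm by simp
    finally show "orbit_norm R (A *v x) \<le> 1 * orbit_norm R x" by simp
  qed
  then have "ball 0 (1 / (C * D)) \<subseteq> {A. op_bound R A 1}"
    by auto
  then have "0 \<in> interior {A. op_bound R A 1}"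
    using C D by (subst mem_interior) (metis divide_pos_pos mult_pos_pos zero_less_one)
  then show ?thesis by blast
qed

text \<open>Elements of \<open>R\<close> are isometries of the orbit norm, so \<open>T\<close> lies
  in the unit ball and the packing bound applies. The dimension is the real one, twice the square of
  the matrix size.\<close>

lemma separated_elements_card_le:
  assumes T: "T \<subseteq> R" and sep: "\<And>x y. x \<in> T \<Longrightarrow> y \<in> T \<Longrightarrow> x \<noteq> y \<Longrightarrow> \<not> op_bound R (x - y) (1/4)"
  shows "card T \<le> 9 ^ DIM(complex^'n^'n)"
proof (rule separated_subset_card_le[OF unit_ball_convex unit_ball_compact unit_ball_interior unit_ball_symmetric])
  show "finite T" using T finite finite_subset by blast
  show "T \<subseteq> {A. op_bound R A 1}" using T op_bound_group by blast
  show "4 *\<^sub>R (x - y) \<notin> {A. op_bound R A 1}" if "x \<in> T" "y \<in> T" "x \<noteq> y" for x y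
    using sep[OF that] by (simp add: op_bound_scaleR)
qed

section \<open>Commutators of elements near the identity\<close>

lemma op_bound_geometric_imp_0:
  assumes "\<And>i. op_bound R A (c * q ^ i)" "\<bar>q\<bar> < 1"
  shows "A = 0"
proof -
  have "orbit_norm R (A *v x) \<le> 0" for x
  proof (rule LIMSEQ_le_const)
    show "(\<lambda>i. c * q ^ i * orbit_norm R x) \<longlonglongrightarrow> 0"
      using assms(2) by (intro tendsto_mult_left_zero tendsto_mult_right_zero LIMSEQ_power_zero) simp
    show "\<exists>N. \<forall>n\<ge>N. orbit_norm R (A *v x) \<le> c * q ^ n * orbit_norm R x"
      using assms(1) by (simp add: op_bound_def)
  qed
  then show ?thesis
    by (intro op_bound_le_0) (simp add: op_bound_def)
qed

text \<open>With d = c^k - 1, the identity 2 d = (c^(2k) - 1) - d^2 improves a bound s \<le> 1/2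
  valid for all powers to (s + s^2)/2 \<le> (3/4) s, again for all powers. Iteration drives the
  bound to 0.\<close>

lemma powers_near_one:
  assumes "\<And>k. op_bound R (mpow c k - mat 1) (1/2)"
  shows "c = mat 1"
proof -
  have step: "op_bound R (mpow c k - mat 1) ((1/2) * (3/4) ^ i)" for i k
  proof (induction i arbitrary: k)
    case 0
    show ?case using assms by simp
  next
    case (Suc i)
    let ?s = "(1/2) * (3/4) ^ i :: real"
    have s: "0 \<le> ?s" "?s \<le> 1/2" by (simp_all add: power_le_one)
    let ?d = "mpow c k - mat 1"
    have "2 *\<^sub>R ?d = (mpow c (k + k) - mat 1) - ?d ** ?d"
      unfolding mpow_add
      by (simp add: matrix_mul_diff_left matrix_mul_diff_right scaleR_2 algebra_simps)
    moreover have "op_bound R ((mpow c (k + k) - mat 1) - ?d ** ?d) (?s + ?s * ?s)"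
      by (intro op_bound_diff op_bound_mult Suc s)
    ultimately have "op_bound R ?d ((?s + ?s * ?s) / 2)"
      by (metis op_bound_scaleR zero_less_numeral)
    moreover have "?s * ?s \<le> ?s * (1/2)"
      using s by (intro mult_left_mono)
    ultimately show ?case
      by (elim op_bound_mono) (simp add: field_simps)
  qed
  have "c - mat 1 = 0"
    using op_bound_geometric_imp_0[of "c - mat 1" "1/2" "3/4"] step[of 1] by simp
  then show ?thesis by simp
qed

lemma mpow_closed: "g \<in> R \<Longrightarrow> mpow g k \<in> R"
  by (induction k) (auto simp: one_closed mult_closed)

text \<open>If \<open>g h g\<inverse> = c h\<close> with \<open>c\<close> commuting with \<open>g\<close>, then \<open>g\<^sup>k h g\<^sup>-\<^sup>k = c\<^sup>k h\<close>,
  so all powers of \<open>c\<close> stay near the identity when \<open>h\<close> is near the identity.\<close>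

lemma commutator_eq_one:
  assumes g: "g \<in> R" and h: "h \<in> R" and c: "c \<in> R"
    and gh: "g ** h = c ** h ** g" and cg: "c ** g = g ** c"
    and small: "op_bound R (h - mat 1) (1/4)"
  shows "c = mat 1"
proof (rule powers_near_one)
  fix k
  have "mpow g k ** h = mpow c k ** h ** mpow g k"
  proof (induction k)
    case (Suc k)
    have "mpow g (Suc k) ** h = g ** mpow c k ** h ** mpow g k"
      by (simp add: Suc flip: matrix_mul_assoc)
    also have "g ** mpow c k = mpow c k ** g"
      using mpow_commute[OF cg] by simp
    also have "mpow c k ** g ** h = mpow c k ** c ** h ** g"
      using gh by (simp flip: matrix_mul_assoc)
    also have "mpow c k ** c = mpow c (Suc k)"
      using mpow_commute[of c c k] by simp
    finally show ?case by (simp flip: matrix_mul_assoc)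
  qed simp
  \<comment> \<open>Both sides equal g^k h - h g^k; subtracting 1 from \<open>h\<close> does not
    change this commutator but makes both terms small.\<close>
  then have "(mpow c k - mat 1) ** (h ** mpow g k) =
      mpow g k ** (h - mat 1) - (h - mat 1) ** mpow g k"
    by (simp add: matrix_mul_diff_left matrix_mul_diff_right matrix_mul_assoc)
  moreover have "op_bound R (mpow g k ** (h - mat 1) - (h - mat 1) ** mpow g k) (1/4 + 1/4)"
    using small by (intro op_bound_diff) (simp_all add: op_bound_mult_left op_bound_mult_right mpow_closed g)
  ultimately show "op_bound R (mpow c k - mat 1) (1/2)"
    using op_bound_mult_right[OF mult_closed[OF h mpow_closed[OF g]], of "mpow c k - mat 1" k] by fastforce
qed

text \<open>Fix \<open>g\<close> and double the allowed distance of \<open>h\<close> from 1 step by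
  step; at the smallest radius only the identity remains. The commutator \<open>c\<close> of
  \<open>g\<close> and \<open>h\<close> is within half the current radius, so it commutes with
  \<open>g\<close> by induction, and \<open>commutator_eq_one\<close> makes it trivial.\<close>

theorem near_one_commute:
  assumes g: "g \<in> R" "op_bound R (g - mat 1) (1/4)"
    and h: "h \<in> R" "op_bound R (h - mat 1) (1/4)"
  shows "g ** h = h ** g"
proof -
  obtain J where J: "\<And>h. h \<in> R \<Longrightarrow> op_bound R (h - mat 1) ((1/4) * (1/2) ^ J) \<Longrightarrow> h = mat 1"
  proof -
    have "\<exists>j. h \<noteq> mat 1 \<longrightarrow> \<not> op_bound R (h - mat 1) ((1/4) * (1/2) ^ j)" for h
    proof (rule ccontr)
      assume "\<not> ?thesis"
      then have *: "h \<noteq> mat 1" "\<And>j. op_bound R (h - mat 1) ((1/4) * (1/2) ^ j)"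
        by auto
      then have "h - mat 1 = 0"
        using op_bound_geometric_imp_0[of "h - mat 1" "1/4" "1/2"] by simp
      with * show False by simp
    qed
    then obtain j where j: "\<And>h. h \<noteq> mat 1 \<Longrightarrow> \<not> op_bound R (h - mat 1) ((1/4) * (1/2) ^ j h)"
      by metis
    \<comment> \<open>Finiteness of \<open>R\<close> gives one exponent that excludes all nontrivial
      elements at once.\<close>
    show ?thesis
    proof (rule that[of "Max (j ` R)"], rule ccontr)
      fix h assume h: "h \<in> R" "op_bound R (h - mat 1) ((1/4) * (1/2) ^ Max (j ` R))" "h \<noteq> mat 1"
      have "(1/2::real) ^ Max (j ` R) \<le> (1/2) ^ j h"
        using h(1) finite by (intro power_decreasing) auto
      with h(2) have "op_bound R (h - mat 1) ((1/4) * (1/2) ^ j h)"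
        by (elim op_bound_mono) simp
      with j h show False by blast
    qed
  qed
  obtain g' where g': "g' \<in> R" "g ** g' = mat 1" "g' ** g = mat 1"
    using inverse_obtain g(1) .
  have "i \<le> J \<Longrightarrow> \<forall>h\<in>R. op_bound R (h - mat 1) ((1/4) * (1/2) ^ (J - i)) \<longrightarrow> g ** h = h ** g" for i
  proof (induction i)
    case 0
    then show ?case using J by fastforce
  next
    case (Suc i)
    show ?case
    proof (intro ballI impI)
      fix h assume h: "h \<in> R" and hb: "op_bound R (h - mat 1) ((1/4) * (1/2) ^ (J - Suc i))"
      let ?e = "(1/4) * (1/2) ^ (J - Suc i) :: real"
      have e: "?e \<le> 1/4" by (simp add: power_le_one)
      obtain h' where h': "h' \<in> R" "h ** h' = mat 1" "h' ** h = mat 1"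
        using inverse_obtain h .
      define c where "c = g ** h ** g' ** h'"
      have c: "c \<in> R" unfolding c_def by (intro mult_closed g h g' h')
      have gh: "c ** (h ** g) = g ** h"
        unfolding c_def by (metis matrix_mul_assoc matrix_mul_rid g'(3) h'(3))
      \<comment> \<open>Both sides are g h - h g. Each product on the right is bounded by
        \<open>?e / 4\<close>, and the factor \<open>h ** g\<close> in \<open>R\<close> leaves
        bounds unchanged, so \<open>c\<close> is within \<open>?e / 2\<close> of 1.\<close>
      have "(c - mat 1) ** (h ** g) = (g - mat 1) ** (h - mat 1) - (h - mat 1) ** (g - mat 1)"
        unfolding matrix_mul_diff_left gh
        by (simp add: matrix_mul_diff_left matrix_mul_diff_right)
      moreover have "op_bound R ((g - mat 1) ** (h - mat 1) - (h - mat 1) ** (g - mat 1)) ((1/4) * ?e + ?e * (1/4))"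
        by (intro op_bound_diff op_bound_mult g hb) simp_all
      ultimately have "op_bound R (c - mat 1) ((1/4) * ?e + ?e * (1/4))"
        using op_bound_mult_right[OF mult_closed[OF h g(1)], of "c - mat 1"] by metis
      also have "(1/4) * ?e + ?e * (1/4) = (1/4) * (1/2) ^ (J - i)"
        using Suc.prems by (simp flip: Suc_diff_Suc)
      finally have "c ** g = g ** c"
        using Suc c by simp
      then have "c = mat 1"
        using commutator_eq_one[OF g(1) h c _ _ op_bound_mono[OF hb e]] gh
        by (simp add: matrix_mul_assoc)
      then show "g ** h = h ** g"
        using gh by simp
    qed
  qed
  from this[of J] show ?thesis using h by simp
qed

end

subsection \<open>Roots of invertible matrices\<close>

lemma mat_mult_commute: "mat c ** B = B ** (mat c :: complex^'n^'n)"
  by (simp add: matrix_matrix_mult_def mat_def vec_eq_iff if_distrib[of "\<lambda>x. x * _"] if_distrib[of "(*) _"]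
      sum.delta sum.delta' mult.commute cong: if_cong)

lemma mat_add: "mat (a + b) = mat a + (mat b :: complex^'n^'n)"
  by (simp add: mat_def vec_eq_iff)

lemma mat_mult: "mat (a * b) = mat a ** (mat b :: complex^'n^'n)"
  by (simp add: matrix_matrix_mult_def mat_def vec_eq_iff if_distrib[of "\<lambda>x. x * _"] if_distrib[of "(*) _"]
      sum.delta sum.delta' cong: if_cong)

lemma mat_of_real_mult: "mat (of_real c) ** B = c *\<^sub>R (B :: complex^'n^'n)"
  by (simp add: matrix_matrix_mult_def mat_def vec_eq_iff if_distrib[of "\<lambda>x. x * _"]
      sum.delta sum.delta' cong: if_cong) (simp add: scaleR_conv_of_real)

lemma matrix_mult_add_left: "(A + B) ** D = A ** D + B ** (D :: complex^'n^'n)"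
  by (simp add: matrix_matrix_mult_def vec_eq_iff distrib_right sum.distrib)

text \<open>Horner's scheme, with scalars embedded as scalar matrices \<open>mat a\<close>; it
  yields the recursion along \<open>pCons\<close> on which the inductions below run.\<close>

definition mat_poly :: "complex poly \<Rightarrow> complex^'n^'n \<Rightarrow> complex^'n^'n"
  where "mat_poly p A = fold_coeffs (\<lambda>a B. mat a + A ** B) p 0"

lemma mat_poly_0: "mat_poly 0 A = 0"
  by (simp add: mat_poly_def)

lemma mat_0: "(mat 0 :: complex^'n^'n) = 0"
  by (simp add: mat_def vec_eq_iff)

lemma matrix_mult_0_right: "A ** 0 = (0 :: complex^'n^'n)"
  by (simp add: matrix_matrix_mult_def vec_eq_iff)

lemma matrix_mult_0_left: "0 ** A = (0 :: complex^'n^'n)"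
  by (simp add: matrix_matrix_mult_def vec_eq_iff)

lemma mat_poly_pCons: "mat_poly (pCons a p) A = mat a + A ** mat_poly p A"
  by (cases "a = 0 \<and> p = 0") (auto simp: mat_poly_def mat_0 matrix_mult_0_right)

lemma mat_poly_add: "mat_poly (p + q) A = mat_poly p A + mat_poly q A"
  by (induction p q rule: poly_induct2)
    (simp_all add: mat_poly_0 mat_poly_pCons mat_add matrix_add_ldistrib)

lemma mat_poly_smult: "mat_poly (Polynomial.smult c p) A = mat c ** mat_poly p A"
proof (induction p)
  case (pCons a p)
  have "mat c ** (A ** mat_poly p A) = A ** (mat c ** mat_poly p A)"
    by (metis matrix_mul_assoc mat_mult_commute)
  with pCons show ?case
    by (simp add: mat_poly_pCons mat_mult matrix_add_ldistrib)
qed (simp add: mat_poly_0 matrix_mult_0_right)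

lemma mat_poly_mult: "mat_poly (p * q) A = mat_poly p A ** mat_poly q A"
  by (induction p)
    (simp_all add: mat_poly_0 mat_poly_pCons mat_poly_add mat_poly_smult mat_0 matrix_mult_0_left
      matrix_mult_add_left matrix_mul_assoc)

lemma mat_poly_power: "mat_poly (p ^ k) A = mpow (mat_poly p A) k"
  by (induction k)
    (simp_all add: mat_poly_mult mat_poly_pCons one_pCons mat_poly_0 matrix_mult_0_right)

lemma mat_poly_diff: "mat_poly (p - q) A = mat_poly p A - mat_poly q A"
  using mat_poly_add[of "p - q" q A] by simp

lemma mat_poly_X: "mat_poly [:0, 1:] A = A"
  by (simp add: mat_poly_pCons mat_poly_0 mat_0 matrix_mult_0_right)

lemma mat_poly_monom: "mat_poly (Polynomial.monom c i) A = mat c ** mpow A i"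
  by (induction i)
    (simp_all add: Polynomial.monom_0 monom_Suc mat_poly_pCons mat_poly_0 mat_0 matrix_mult_0_right,
     metis matrix_mul_assoc mat_mult_commute)

lemma mat_poly_sum: "mat_poly (\<Sum>i\<in>S. p i) A = (\<Sum>i\<in>S. mat_poly (p i) A)"
  by (induction S rule: infinite_finite_induct) (simp_all add: mat_poly_0 mat_poly_add)

text \<open>This is why a root built as a polynomial in \<open>A\<close> commutes with the whole
  centralizer of \<open>A\<close>.\<close>

lemma mat_poly_commute:
  assumes "A ** B = B ** A"
  shows "mat_poly p A ** B = B ** mat_poly p A"
proof (induction p)
  case (pCons a p)
  have "A ** mat_poly p A ** B = B ** (A ** mat_poly p A)"
    using pCons assms by (metis matrix_mul_assoc)
  then show ?case
    by (simp add: mat_poly_pCons matrix_add_ldistrib matrix_mult_add_left mat_mult_commute)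
qed (simp add: mat_poly_0 matrix_mult_0_left matrix_mult_0_right)

text \<open>There is one more exponent than the real dimension of the matrix space, so either two
  powers coincide or the powers are linearly dependent over the reals. The cases are split because
  coinciding powers collapse in the image set.\<close>

lemma annihilating_poly:
  fixes A :: "complex^'n^'n"
  obtains p where "p \<noteq> 0" "mat_poly p A = 0"
proof (cases "inj_on (mpow A) {..DIM(complex^'n^'n)}")
  case False
  then obtain i j where ij: "i \<noteq> j" "mpow A i = mpow A j"
    by (auto simp: inj_on_def)
  let ?p = "Polynomial.monom 1 i - Polynomial.monom (1::complex) j"
  have "poly.coeff ?p i \<noteq> 0"
    using ij by simp
  then have "?p \<noteq> 0"
    by (metis coeff_0)
  moreover have "mat_poly ?p A = 0"
    using ij by (simp add: mat_poly_diff mat_poly_monom)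
  ultimately show ?thesis by (rule that)
next
  case inj: True
  let ?d = "DIM(complex^'n^'n)"
  have "dependent (mpow A ` {..?d})"
    by (rule dependent_biggerset, unfold card_image[OF inj]) simp
  then obtain u where u: "\<exists>v\<in>mpow A ` {..?d}. u v \<noteq> 0" "(\<Sum>v\<in>mpow A ` {..?d}. u v *\<^sub>R v) = 0"
    using real_vector.dependent_finite[of "mpow A ` {..?d}"] by auto
  then obtain i where i: "i \<le> ?d" "u (mpow A i) \<noteq> 0"
    by auto
  let ?p = "\<Sum>i\<le>?d. Polynomial.monom (complex_of_real (u (mpow A i))) i"
  have "poly.coeff ?p i \<noteq> 0"
    using i by (simp add: coeff_sum)
  then have "?p \<noteq> 0"
    by (metis coeff_0)
  moreover have "mat_poly ?p A = 0"
    using u(2) sum.reindex[OF inj, of "\<lambda>v. u v *\<^sub>R v"]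
    by (simp add: mat_poly_sum mat_poly_monom mat_of_real_mult)
  ultimately show ?thesis by (rule that)
qed

text \<open>Root extraction modulo \<open>p\<close> by adding one root \<open>a\<close> of \<open>p\<close> at a time: given \<open>q\<close> with
  \<open>p dvd q\<^sup>k - x\<close>, a suitable \<open>q + c p\<close> solves the problem modulo \<open>(x - a) p\<close>; \<open>c\<close> is determined
  by a linear equation if \<open>p\<close> vanishes at \<open>a\<close> (a Hensel step) and by a \<open>k\<close>-th root of \<open>a\<close> otherwise.\<close>

lemma poly_kth_root_mod:
  fixes p :: "complex poly"
  assumes k: "k > 0" and p0: "poly p 0 \<noteq> 0"
  shows "\<exists>q. p dvd q ^ k - [:0, 1:]"
  using p0
proof (induction "Polynomial.degree p" arbitrary: p)
  case 0
  then have "is_unit p"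
    by (metis is_unit_iff_degree poly_0)
  then show ?case
    using unit_imp_dvd by blast
next
  case (Suc n)
  then obtain a where a: "poly p a = 0"
    using alg_closed_imp_poly_has_root[of p] by auto
  then obtain r where r: "p = [:-a, 1:] * r"
    by (auto simp: poly_eq_0_iff_dvd elim: dvdE)
  have a0: "a \<noteq> 0" using a Suc.prems by auto
  have "r \<noteq> 0" using Suc.prems r by auto
  then have "Polynomial.degree p = Polynomial.degree [:-a, 1:] + Polynomial.degree r"
    unfolding r by (intro degree_mult_eq) simp_all
  then have "n = Polynomial.degree r"
    using Suc.hyps(2) by simp
  moreover have "poly r 0 \<noteq> 0"
    using Suc.prems r by auto
  ultimately obtain q where "r dvd q ^ k - [:0, 1:]"
    using Suc.hyps(1) by blast
  then obtain s where s: "q ^ k - [:0, 1:] = r * s" ..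
  \<comment> \<open>Factoring the difference of \<open>k\<close>-th powers displays the new cofactor
    of \<open>r\<close> as a function of \<open>c\<close>; it remains to choose \<open>c\<close> so
    that this cofactor vanishes at \<open>a\<close>.\<close>
  have expand: "(q + Polynomial.smult c r) ^ k - [:0, 1:] =
      r * (s + Polynomial.smult c (\<Sum>i<k. q ^ (k - Suc i) * (q + Polynomial.smult c r) ^ i))" for c
  proof -
    have "(q + Polynomial.smult c r) ^ k - [:0, 1:] =
        ((q + Polynomial.smult c r) ^ k - q ^ k) + (q ^ k - [:0, 1:])"
      by (simp only: add_diff_eq diff_add_cancel)
    then show ?thesis
      unfolding s power_diff_sumr2 by (simp add: distrib_left)
  qed
  have "\<exists>c t. (q + Polynomial.smult c r) ^ k - [:0, 1:] = r * t \<and> poly t a = 0"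
  proof (cases "poly r a = 0")
    case False
    obtain z where z: "z ^ k = a"
      using k by (metis exists_complex_root neq0_conv)
    \<comment> \<open>This choice gives the new polynomial the value \<open>z\<close> at
      \<open>a\<close>, so the product of \<open>r\<close> and its cofactor vanishes there while
      \<open>r\<close> does not.\<close>
    let ?c = "(z - poly q a) / poly r a"
    obtain t where t: "(q + Polynomial.smult ?c r) ^ k - [:0, 1:] = r * t"
      using expand by blast
    have "poly ((q + Polynomial.smult ?c r) ^ k - [:0, 1:]) a = 0"
      using False z by simp
    then have "poly t a = 0"
      using False unfolding t by simp
    with t show ?thesis by blast
  next
    case True
    have "poly (q ^ k - [:0, 1:]) a = 0"
      using s True by simp
    then have qa: "poly q a ^ k = a"
      by simp
    then have qa0: "poly q a \<noteq> 0"
      using a0 k by auto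
    \<comment> \<open>As \<open>r\<close> vanishes at \<open>a\<close>, each summand has the value
      q(a)^(k-1) there, so the cofactor is s(a) + c k q(a)^(k-1). The denominator is nonzero because
      q(a)^k = a is.\<close>
    let ?c = "- poly s a / (of_nat k * poly q a ^ (k - 1))"
    let ?u = "q + Polynomial.smult ?c r"
    let ?t = "s + Polynomial.smult ?c (\<Sum>i<k. q ^ (k - Suc i) * ?u ^ i)"
    have "?u ^ k - [:0, 1:] = r * ?t"
      by (rule expand)
    moreover have "poly ?t a = 0"
    proof -
      have "poly (\<Sum>i<k. q ^ (k - Suc i) * ?u ^ i) a = (\<Sum>i<k. poly q a ^ (k - 1))"
        unfolding poly_sum by (intro sum.cong) (auto simp: True simp flip: power_add)
      then show ?thesis
        using qa0 k by simp
    qed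
    ultimately show ?thesis by blast
  qed
  then obtain c t where t: "(q + Polynomial.smult c r) ^ k - [:0, 1:] = r * t" "[:-a, 1:] dvd t"
    by (auto simp: poly_eq_0_iff_dvd)
  then have "p dvd (q + Polynomial.smult c r) ^ k - [:0, 1:]"
    unfolding t(1) r by (subst mult.commute) (intro mult_dvd_mono dvd_refl)
  then show ?case by blast
qed

text \<open>If p(A) = 0 and p(0) is nonzero, then a \<open>k\<close>-th root \<open>q\<close> of the
  indeterminate modulo \<open>p\<close> satisfies q(A)^k = A.\<close>

theorem invertible_kth_root:
  fixes A :: "complex^'n^'n"
  assumes A: "invertible A" and k: "k > 0"
  obtains D where "mpow D k = A" "\<And>B. A ** B = B ** A \<Longrightarrow> D ** B = B ** D"
proof -
  obtain A' where A': "A' ** A = mat 1"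
    using A by (auto simp: invertible_def)
  have cancel: "B = 0" if "A ** B = 0" for B
  proof -
    have "B = A' ** (A ** B)"
      using A' by (simp add: matrix_mul_assoc)
    with that show ?thesis by (simp add: matrix_mult_0_right)
  qed
  \<comment> \<open>Factors of the indeterminate are stripped from an annihilating polynomial:
    \<open>A\<close> can be cancelled, and the degree drops each time.\<close>
  have "\<exists>p. poly p 0 \<noteq> 0 \<and> mat_poly p A = 0"
  proof -
    obtain p where p: "p \<noteq> 0" "mat_poly p A = 0"
      using annihilating_poly .
    then show ?thesis
    proof (induction "Polynomial.degree p" arbitrary: p rule: less_induct)
      case less
      show ?case
      proof (cases "poly p 0 = 0")
        case True
        then obtain r where r: "p = pCons 0 r"
          by (cases p) auto
        then have "r \<noteq> 0" "mat_poly r A = 0"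
          using less.prems cancel by (auto simp: mat_poly_pCons mat_0)
        then show ?thesis
          using less.hyps[of r] r by simp
      next
        case False
        with less.prems show ?thesis by blast
      qed
    qed
  qed
  then obtain p where p: "poly p 0 \<noteq> 0" "mat_poly p A = 0" by blast
  then obtain q where "p dvd q ^ k - [:0, 1:]"
    using poly_kth_root_mod k by blast
  then obtain s where "q ^ k - [:0, 1:] = p * s" ..
  then have "mat_poly (q ^ k - [:0, 1:]) A = 0"
    using p by (simp add: mat_poly_mult matrix_mult_0_left)
  then have "mpow (mat_poly q A) k = A"
    by (simp add: mat_poly_diff mat_poly_power mat_poly_X)
  then show ?thesis
    using that mat_poly_commute by blast
qed

subsection \<open>Groups with an infinite cyclic normal subgroup\<close>

lemma (in group) int_pow_commute:
  assumes "x \<in> carrier G" "y \<in> carrier G" "x \<otimes> y = y \<otimes> x"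
  shows "x [^] (i::int) \<otimes> y = y \<otimes> x [^] i"
proof -
  have nat: "x [^] n \<otimes> y = y \<otimes> x [^] n" for n :: nat
    using assms group_commutes_pow by blast
  show ?thesis
  proof (cases i)
    case (nonneg n)
    with nat show ?thesis by (simp add: int_pow_int)
  next
    case (neg n)
    \<comment> \<open>The case \<open>neg n\<close> stands for the exponent -(n + 1), hence
      \<open>Suc n\<close>.\<close>
    define w where "w = x [^] Suc n"
    have w: "w \<in> carrier G" "w \<otimes> y = y \<otimes> w"
      using assms(1) nat unfolding w_def by blast+
    have "inv w \<otimes> y = inv w \<otimes> (y \<otimes> w) \<otimes> inv w"
      using assms w(1) by (simp add: m_assoc)
    also have "\<dots> = inv w \<otimes> (w \<otimes> y) \<otimes> inv w"
      by (simp only: w(2))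
    also have "\<dots> = y \<otimes> inv w"
      using assms w(1) by (simp add: m_assoc[symmetric])
    finally show ?thesis
      using assms neg by (simp add: int_pow_neg_int w_def del: of_nat_Suc nat_pow_Suc)
  qed
qed

text \<open>Conjugation by \<open>m\<close> is an endomorphism, and homomorphisms preserve integer
  powers.\<close>

lemma (in group) int_pow_conj:
  assumes "m \<in> carrier G" "x \<in> carrier G"
  shows "(m \<otimes> x \<otimes> inv m) [^] (i::int) = m \<otimes> x [^] i \<otimes> inv m"
proof -
  have "inv m \<otimes> (m \<otimes> u) = u" if "u \<in> carrier G" for u
    using assms(1) that by (simp add: m_assoc[symmetric])
  then have "(\<lambda>x. m \<otimes> x \<otimes> inv m) \<in> hom G G"
    using assms(1) by (intro homI) (simp_all add: m_assoc)
  then interpret group_hom G G "\<lambda>x. m \<otimes> x \<otimes> inv m"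
    by unfold_locales
  show ?thesis
    using hom_int_pow[OF assms(2)] by simp
qed

text \<open>Taken relative to \<open>H\<close>, this serves both for the centralizer of the
  generator in \<open>M\<close> and for a double centralizer inside that group.\<close>

lemma (in group) subgroup_centralizer:
  assumes H: "subgroup H G" and S: "S \<subseteq> carrier G"
  shows "subgroup {h \<in> H. \<forall>x\<in>S. h \<otimes> x = x \<otimes> h} G"
proof (rule subgroupI)
  interpret H: subgroup H G by fact
  show "{h \<in> H. \<forall>x\<in>S. h \<otimes> x = x \<otimes> h} \<subseteq> carrier G"
    by auto
  show "{h \<in> H. \<forall>x\<in>S. h \<otimes> x = x \<otimes> h} \<noteq> {}"
    using S by (auto intro!: exI[of _ \<one>])
  fix a assume a: "a \<in> {h \<in> H. \<forall>x\<in>S. h \<otimes> x = x \<otimes> h}"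
  have "inv a \<otimes> x = x \<otimes> inv a" if "x \<in> S" for x
    using int_pow_commute[of a x "-1"] a S that by (auto simp: int_pow_neg)
  with a show "inv a \<in> {h \<in> H. \<forall>x\<in>S. h \<otimes> x = x \<otimes> h}"
    by auto
  fix b assume b: "b \<in> {h \<in> H. \<forall>x\<in>S. h \<otimes> x = x \<otimes> h}"
  have "a \<otimes> b \<otimes> x = x \<otimes> (a \<otimes> b)" if "x \<in> S" for x
  proof -
    have c: "a \<in> carrier G" "b \<in> carrier G" "x \<in> carrier G"
      using a b S that by auto
    have "a \<otimes> b \<otimes> x = a \<otimes> x \<otimes> b"
      using b c that by (simp add: m_assoc)
    also have "\<dots> = x \<otimes> (a \<otimes> b)"
      using a c that by (simp add: m_assoc)
    finally show ?thesis .
  qed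
  with a b show "a \<otimes> b \<in> {h \<in> H. \<forall>x\<in>S. h \<otimes> x = x \<otimes> h}"
    by auto
qed

text \<open>This is the transfer \<open>G \<rightarrow> N\<close>, with \<open>N\<close> written additively.\<close>

lemma (in group) transfer_to_int:
  assumes N: "subgroup N G" and N_eq: "N = range (\<lambda>j::int. z [^] j)" and z: "z \<in> carrier G"
    and central: "\<And>x. x \<in> carrier G \<Longrightarrow> x \<otimes> z = z \<otimes> x"
    and inj: "inj (\<lambda>j::int. z [^] j)"
    and fin: "finite (rcosets N)"
  obtains V :: "'a \<Rightarrow> int" and k :: nat
  where "k > 0" "V z = int k"
    "\<And>x y. x \<in> carrier G \<Longrightarrow> y \<in> carrier G \<Longrightarrow> V (x \<otimes> y) = V x + V y"
proof -
  define rep where "rep C = (SOME x. x \<in> C)" for C :: "'a set"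
  have ex: "\<exists>j::int. x = z [^] j \<otimes> rep (N #> x)" and rep: "rep (N #> x) \<in> carrier G"
    and crep: "N #> rep (N #> x) = N #> x" if x: "x \<in> carrier G" for x
  proof -
    have mem: "rep (N #> x) \<in> N #> x"
      unfolding rep_def using rcos_self[OF x N] by (rule someI)
    then show c: "rep (N #> x) \<in> carrier G"
      using N x r_coset_subset_G subgroup.subset by blast
    show eq: "N #> rep (N #> x) = N #> x"
      using repr_independence[OF mem x N] by simp
    have "x \<in> N #> rep (N #> x)"
      unfolding eq by (rule rcos_self[OF x N])
    then show "\<exists>j::int. x = z [^] j \<otimes> rep (N #> x)"
      by (auto simp: r_coset_def N_eq)
  qed
  \<comment> \<open>The power of \<open>z\<close> leading from the chosen representative of the
    coset to \<open>x\<close>; injectivity makes the exponent unique, so \<open>s_shift\<close>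
    holds.\<close>
  define s where "s x = (SOME j::int. x = z [^] j \<otimes> rep (N #> x))" for x
  have s: "x = z [^] s x \<otimes> rep (N #> x)" if "x \<in> carrier G" for x
    unfolding s_def using someI_ex[OF ex[OF that]] .
  have coset_shift: "N #> (z [^] i \<otimes> x) = N #> x" if "x \<in> carrier G" for i :: int and x
  proof -
    have "z [^] i \<otimes> x \<in> N #> x"
      by (auto simp: r_coset_def N_eq)
    then show ?thesis
      using repr_independence[OF _ that N] by simp
  qed
  have s_shift: "s (z [^] i \<otimes> x) = i + s x" if x: "x \<in> carrier G" for i :: int and x
  proof -
    have c: "z [^] i \<otimes> x \<in> carrier G" using x z by simp
    have "z [^] s (z [^] i \<otimes> x) \<otimes> rep (N #> x) = z [^] i \<otimes> x"
      using s[OF c, symmetric] by (simp only: coset_shift[OF x])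
    also have "\<dots> = z [^] (i + s x) \<otimes> rep (N #> x)"
      using arg_cong[OF s[OF x], of "\<lambda>u. z [^] i \<otimes> u"] z rep[OF x]
      by (simp only: int_pow_mult int_pow_closed m_assoc)
    finally have "z [^] s (z [^] i \<otimes> x) = z [^] (i + s x)"
      using z rep[OF x] by simp
    then show ?thesis
      using inj by (simp add: inj_eq)
  qed
  \<comment> \<open>The difference s(u g) - s(u) is unchanged when \<open>u\<close> is multiplied on
    the left by a power of \<open>z\<close>, so each summand depends only on the coset.\<close>
  define V where "V g = (\<Sum>C\<in>rcosets N. s (rep C \<otimes> g) - s (rep C))" for g
  have rcosE: "\<exists>x\<in>carrier G. C = N #> x" if "C \<in> rcosets N" for C
    using that by (auto simp: RCOSETS_def)
  have rep': "rep C \<in> carrier G" "N #> rep C = C" if "C \<in> rcosets N" for C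
    using rcosE[OF that] rep crep by auto
  have in_rcos: "N #> x \<in> rcosets N" if "x \<in> carrier G" for x
    using that by (auto simp: RCOSETS_def)
  have "V (x \<otimes> y) = V x + V y" if x: "x \<in> carrier G" and y: "y \<in> carrier G" for x y
  proof -
    define f where "f u = s (u \<otimes> y) - s u" for u
    have f_rep: "f (rep (N #> u)) = f u" if u: "u \<in> carrier G" for u
    proof -
      have "f u = f (z [^] s u \<otimes> rep (N #> u))"
        by (simp only: s[OF u, symmetric])
      also have "\<dots> = f (rep (N #> u))"
        unfolding f_def using u y z rep[OF u] by (simp add: m_assoc s_shift)
      finally show ?thesis by simp
    qed
    have shift: "N #> (rep (N #> (rep C \<otimes> u)) \<otimes> inv u) = C"
      if C: "C \<in> rcosets N" and u: "u \<in> carrier G" for C u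
    proof -
      let ?w = "rep C \<otimes> u"
      have w: "?w \<in> carrier G" using rep' C u by simp
      have "N #> rep (N #> ?w) \<otimes> inv u = (N #> rep (N #> ?w)) #> inv u"
        using u rep[OF w] subgroup.subset[OF N] by (simp add: coset_mult_assoc)
      also have "\<dots> = N #> (?w \<otimes> inv u)"
        using u w crep[OF w] subgroup.subset[OF N] by (simp add: coset_mult_assoc)
      also have "?w \<otimes> inv u = rep C"
        using u rep'[OF C] by (simp add: m_assoc)
      finally show ?thesis using rep'[OF C] by simp
    qed
    \<comment> \<open>Insert s(\<open>rep C\<close> x) and split the sum. The first part is then
      rewritten with the representative of the coset C x, and C \<mapsto> C x permutes the
      cosets.\<close>
    have "V (x \<otimes> y) = (\<Sum>C\<in>rcosets N. f (rep C \<otimes> x)) + V x"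
      unfolding V_def sum.distrib[symmetric]
      by (intro sum.cong) (simp_all add: f_def rep' m_assoc x y)
    also have "(\<Sum>C\<in>rcosets N. f (rep C \<otimes> x)) = (\<Sum>C\<in>rcosets N. f (rep (N #> (rep C \<otimes> x))))"
      by (intro sum.cong refl f_rep[symmetric]) (simp add: rep' x)
    also have "\<dots> = (\<Sum>C\<in>rcosets N. f (rep C))"
    proof (rule sum.reindex_bij_witness[of _ "\<lambda>C. N #> (rep C \<otimes> inv x)" "\<lambda>C. N #> (rep C \<otimes> x)"])
      fix C assume C: "C \<in> rcosets N"
      show "N #> (rep (N #> (rep C \<otimes> x)) \<otimes> inv x) = C"
        using shift C x .
      show "N #> (rep (N #> (rep C \<otimes> inv x)) \<otimes> x) = C"
        using shift[OF C, of "inv x"] x by simp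
      show "N #> (rep C \<otimes> x) \<in> rcosets N" "N #> (rep C \<otimes> inv x) \<in> rcosets N"
        using rep'[OF C] x by (simp_all add: in_rcos)
    qed simp
    also have "\<dots> = V y"
      by (simp add: V_def f_def)
    finally show ?thesis by simp
  qed
  moreover have "V z = int (card (rcosets N))"
  proof -
    \<comment> \<open>Centrality moves \<open>z\<close> to the left, so every coset contributes
      1.\<close>
    have "s (rep C \<otimes> z) - s (rep C) = 1" if "C \<in> rcosets N" for C
      using s_shift[of "rep C" 1] rep'[OF that] central z by simp
    then show ?thesis by (simp add: V_def)
  qed
  moreover have "card (rcosets N) > 0"
    using fin in_rcos[OF one_closed] by (auto simp: card_gt_0_iff)
  ultimately show ?thesis using that by blast
qed

text \<open>Conjugation acts on an infinite cyclic normal subgroup by \<open>\<plusminus>1\<close>.\<close>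

lemma (in group) centralizer_index_le_2:
  assumes z: "z \<in> carrier G" and inj: "inj (\<lambda>j::int. z [^] j)"
    and H: "subgroup H G"
    and norm: "\<And>m. m \<in> H \<Longrightarrow> m \<otimes> z \<otimes> inv m \<in> range (\<lambda>j::int. z [^] j)"
    and xyH: "x \<in> H" "y \<in> H"
    and nc: "x \<otimes> z \<noteq> z \<otimes> x" "y \<otimes> z \<noteq> z \<otimes> y"
  shows "(x \<otimes> inv y) \<otimes> z = z \<otimes> (x \<otimes> inv y)"
proof -
  have xy: "x \<in> carrier G" "y \<in> carrier G"
    using xyH subgroup.subset[OF H] by auto
  have inverts: "m \<otimes> z \<otimes> inv m = inv z" if mH: "m \<in> H" and mz: "m \<otimes> z \<noteq> z \<otimes> m" for m
  proof -
    have m: "m \<in> carrier G"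
      using mH subgroup.subset[OF H] by auto
    obtain j :: int where j: "m \<otimes> z \<otimes> inv m = z [^] j"
      using norm[OF mH] by auto
    obtain i :: int where i: "inv m \<otimes> z \<otimes> m = z [^] i"
      using norm[OF subgroup.m_inv_closed[OF H mH]] m by auto
    \<comment> \<open>Conjugating by \<open>inv m\<close> and then by \<open>m\<close> returns
      \<open>z\<close>, so \<open>j\<close> is a unit of the integers; \<open>j = 1\<close> would
      mean that \<open>m\<close> commutes with \<open>z\<close>.\<close>
    have "z [^] (j * i) = (m \<otimes> z \<otimes> inv m) [^] i"
      using z by (simp add: j int_pow_pow)
    also have "\<dots> = m \<otimes> (inv m \<otimes> z \<otimes> m) \<otimes> inv m"
      using m z by (simp add: int_pow_conj i)
    also have "\<dots> = z [^] (1::int)"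
      using m z by (simp add: m_assoc) (simp add: m_assoc[symmetric])
    finally have "j * i = 1"
      using inj by (simp add: inj_eq)
    then have "j = 1 \<or> j = -1"
      by (auto simp: zmult_eq_1_iff)
    moreover have "j \<noteq> 1"
      using j mz m z int_pow_1 inv_solve_right' m_closed by metis
    ultimately show ?thesis
      using j z by (simp add: int_pow_neg)
  qed
  \<comment> \<open>Both \<open>inv y\<close> and \<open>x\<close> invert \<open>z\<close>, so their
    product fixes it.\<close>
  have "(x \<otimes> inv y) \<otimes> z \<otimes> inv (x \<otimes> inv y) = x \<otimes> (inv y \<otimes> z \<otimes> y) \<otimes> inv x"
    using xy z by (simp add: inv_mult_group m_assoc)
  also have "inv y \<otimes> z \<otimes> y = inv z"
  proof -
    have "y \<otimes> inv z \<otimes> inv y = inv (y \<otimes> z \<otimes> inv y)"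
      using xy z by (simp add: inv_mult_group m_assoc)
    also have "\<dots> = z"
      using inverts[OF xyH(2) nc(2)] z by simp
    finally have yzy: "y \<otimes> inv z \<otimes> inv y = z" .
    have "z \<otimes> y = y \<otimes> inv z \<otimes> inv y \<otimes> y"
      by (simp only: yzy)
    also have "\<dots> = y \<otimes> inv z"
      using xy z by (simp add: m_assoc)
    finally have "z \<otimes> y = y \<otimes> inv z" .
    then have "inv y \<otimes> (z \<otimes> y) = inv y \<otimes> (y \<otimes> inv z)"
      by simp
    then show ?thesis
      using xy z by (simp add: m_assoc[symmetric])
  qed
  also have "x \<otimes> inv z \<otimes> inv x = inv (x \<otimes> z \<otimes> inv x)"
    using xy z by (simp add: inv_mult_group m_assoc)
  also have "\<dots> = z"
    using inverts[OF xyH(1) nc(1)] z by simp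
  finally show ?thesis
    using xy z by (metis inv_closed inv_solve_right' m_closed)
qed

text \<open>The image of \<open>A\<close> in the quotient is an abelian subgroup. The index bound
  \<open>idx\<close> is a pigeonhole statement: applied to one preimage per coset of the image, it
  puts two of them into the same coset if there are more than \<open>n\<close>.\<close>

lemma (in group) min_abelian_index_Mod_le:
  assumes N: "normal N G" and A: "subgroup A G"
    and comm: "\<And>x y. x \<in> A \<Longrightarrow> y \<in> A \<Longrightarrow> x \<otimes> y = y \<otimes> x"
    and idx: "\<And>T. T \<subseteq> carrier G \<Longrightarrow> card T > n \<Longrightarrow> \<exists>x\<in>T. \<exists>y\<in>T. x \<noteq> y \<and> x \<otimes> inv y \<in> A"
  shows "min_abelian_index (G Mod N) \<le> n"
proof -
  interpret N: normal N G by fact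
  interpret Q: group "G Mod N" by (rule N.factorgroup_is_group)
  interpret p: group_hom G "G Mod N" "\<lambda>x. N #> x"
    by unfold_locales (rule N.r_coset_hom_Mod)
  let ?A = "(\<lambda>x. N #> x) ` A"
  have A': "subgroup ?A (G Mod N)"
    by (rule p.subgroup_img_is_subgroup[OF A])
  have "comm_group ((G Mod N)\<lparr>carrier := ?A\<rparr>)"
  proof (rule group.group_comm_groupI)
    show "group ((G Mod N)\<lparr>carrier := ?A\<rparr>)"
      using A' Q.subgroup_imp_group by blast
    fix u v assume "u \<in> carrier ((G Mod N)\<lparr>carrier := ?A\<rparr>)" "v \<in> carrier ((G Mod N)\<lparr>carrier := ?A\<rparr>)"
    then obtain x y where xy: "x \<in> A" "y \<in> A" "u = N #> x" "v = N #> y" by auto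
    then have c: "x \<in> carrier G" "y \<in> carrier G" using subgroup.subset[OF A] by auto
    have "N #> (x \<otimes> y) = u \<otimes>\<^bsub>G Mod N\<^esub> v" "N #> (y \<otimes> x) = v \<otimes>\<^bsub>G Mod N\<^esub> u"
      unfolding xy by (rule p.hom_mult[OF c], rule p.hom_mult[OF c(2,1)])
    then have "u \<otimes>\<^bsub>G Mod N\<^esub> v = v \<otimes>\<^bsub>G Mod N\<^esub> u"
      using comm[OF xy(1,2)] by simp
    then show "u \<otimes>\<^bsub>(G Mod N)\<lparr>carrier := ?A\<rparr>\<^esub> v = v \<otimes>\<^bsub>(G Mod N)\<lparr>carrier := ?A\<rparr>\<^esub> u"
      by simp
  qed
  with A' have le: "min_abelian_index (G Mod N) \<le> card (rcosets\<^bsub>G Mod N\<^esub> ?A)"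
    unfolding min_abelian_index_def by (intro Least_le) blast
  have "card (rcosets\<^bsub>G Mod N\<^esub> ?A) \<le> n"
  proof (rule ccontr)
    assume "\<not> ?thesis"
    then have gt: "card (rcosets\<^bsub>G Mod N\<^esub> ?A) > n" by simp
    let ?c = "\<lambda>x. ?A #>\<^bsub>G Mod N\<^esub> (N #> x)"
    have "rcosets\<^bsub>G Mod N\<^esub> ?A \<subseteq> ?c ` carrier G"
      by (auto simp: RCOSETS_def FactGroup_def)
    then obtain T where T: "T \<subseteq> carrier G" "inj_on ?c T" "rcosets\<^bsub>G Mod N\<^esub> ?A = ?c ` T"
      unfolding subset_image_inj by blast
    have "card T > n"
      using gt unfolding T(3) card_image[OF T(2)] .
    from idx[OF T(1) this] obtain x y where xy: "x \<in> T" "y \<in> T" "x \<noteq> y" "x \<otimes> inv y \<in> A"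
      by blast
    have c: "x \<in> carrier G" "y \<in> carrier G" using xy T by auto
    have "N #> x = N #> ((x \<otimes> inv y) \<otimes> y)"
      using c by (simp add: m_assoc)
    also have "\<dots> = (N #> (x \<otimes> inv y)) \<otimes>\<^bsub>G Mod N\<^esub> (N #> y)"
      by (rule p.hom_mult) (use c in auto)
    also have "\<dots> \<in> ?c y"
      using xy(4) unfolding r_coset_def[of "G Mod N"] by blast
    finally have "?c y = ?c x"
      by (rule Q.repr_independence[OF _ p.hom_closed A']) (use c in simp)
    then show False
      using inj_onD[OF T(2)] xy(1-3) by blast
  qed
  with le show ?thesis by simp
qed

section \<open>The abelian subgroup of bounded index\<close>

lemma mpow_eq_nat_pow:
  assumes "A \<in> carrier GL"
  shows "mpow A k = A [^]\<^bsub>GL\<^esub> k"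
proof (induction k)
  case (Suc k)
  then show ?case
    using GL.nat_pow_Suc2[OF assms, of k] by (simp add: mult_GL)
qed (simp add: one_GL)

text \<open>Splitting off one factor exhibits a right inverse of \<open>A\<close>, which suffices
  for square matrices. This places the root \<open>D\<close> in \<open>GL\<close>.\<close>

lemma mpow_invertible_imp:
  assumes "invertible (mpow A k)" "k > 0"
  shows "invertible A"
proof -
  obtain j where "k = Suc j" using assms(2) gr0_implies_Suc by blast
  with assms(1) obtain B where "A ** (mpow A j ** B) = mat 1"
    by (auto simp: invertible_def matrix_mul_assoc)
  then show ?thesis
    using invertible_right_inverse by blast
qed

text \<open>The subgroup is a double centralizer of the elements whose image under
  \<open>\<rho>\<close> is near 1. Its index is bounded in the form that
  \<open>min_abelian_index_Mod_le\<close> consumes; the factor 2 accounts for the elements of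
  \<open>M\<close> that do not commute with \<open>z\<close>.\<close>

theorem virtually_cyclic_abelian_subgroup:
  fixes M :: "(complex^'n^'n) set"
  assumes M: "subgroup M GL" and N: "subgroup N GL" "N \<subseteq> M"
    and N_eq: "N = range (\<lambda>j::int. z [^]\<^bsub>GL\<^esub> j)"
    and inj: "inj (\<lambda>j::int. z [^]\<^bsub>GL\<^esub> j)" and zM: "z \<in> M"
    and norm: "\<forall>m\<in>M. m \<otimes>\<^bsub>GL\<^esub> z \<otimes>\<^bsub>GL\<^esub> inv\<^bsub>GL\<^esub> m \<in> N"
    and fin: "finite ((\<lambda>x. N #>\<^bsub>GL\<^esub> x) ` M)"
  shows "\<exists>A. subgroup A GL \<and> A \<subseteq> M \<and> (\<forall>x\<in>A. \<forall>y\<in>A. x ** y = y ** x) \<and>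
    (\<forall>T. T \<subseteq> M \<longrightarrow> card T > 2 * 9 ^ DIM(complex^'n^'n) \<longrightarrow>
      (\<exists>x\<in>T. \<exists>y\<in>T. x \<noteq> y \<and> x \<otimes>\<^bsub>GL\<^esub> inv\<^bsub>GL\<^esub> y \<in> A))"
proof -
  let ?G = "GL :: (complex^'n^'n) monoid"
  let ?n = "9 ^ DIM(complex^'n^'n) :: nat"
  have z: "z \<in> carrier ?G"
    using zM subgroup.subset[OF M] by blast
  define H where "H = {h \<in> M. \<forall>x\<in>{z}. h \<otimes>\<^bsub>GL\<^esub> x = x \<otimes>\<^bsub>GL\<^esub> h}"
  have H: "subgroup H GL"
    unfolding H_def by (rule GL.subgroup_centralizer[OF M]) (use z in simp)
  have HsubM: "H \<subseteq> M"
    by (auto simp: H_def)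
  have Hz: "h \<otimes>\<^bsub>GL\<^esub> z = z \<otimes>\<^bsub>GL\<^esub> h" if "h \<in> H" for h
    using that by (auto simp: H_def)
  have Hc: "h \<in> carrier GL" if "h \<in> H" for h
    using that subgroup.subset[OF H] by blast
  have zH: "z \<in> H"
    using zM by (simp add: H_def)
  have NH: "N \<subseteq> H"
  proof
    fix x assume x: "x \<in> N"
    then have "x \<otimes>\<^bsub>GL\<^esub> z = z \<otimes>\<^bsub>GL\<^esub> x"
      using GL.int_pow_commute[OF z z] by (auto simp: N_eq)
    then show "x \<in> H" using x N(2) by (auto simp: H_def)
  qed
  let ?H = "GL\<lparr>carrier := H\<rparr>"
  have pow_H: "x [^]\<^bsub>?H\<^esub> (j::int) = x [^]\<^bsub>GL\<^esub> j" if "x \<in> H" for x j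
    using GL.int_pow_consistent[OF H that] by simp
  interpret H: group ?H
    by (rule GL.subgroup_imp_group[OF H])
  obtain V :: "complex^'n^'n \<Rightarrow> int" and k :: nat where k: "k > 0" and Vz: "V z = int k"
    and V: "\<And>x y. x \<in> H \<Longrightarrow> y \<in> H \<Longrightarrow> V (x \<otimes>\<^bsub>GL\<^esub> y) = V x + V y"
  proof (rule H.transfer_to_int[of N z])
    show "subgroup N ?H"
      using GL.subgroup_incl[OF N(1) H NH] .
    show "N = range (\<lambda>j::int. z [^]\<^bsub>?H\<^esub> j)" "inj (\<lambda>j::int. z [^]\<^bsub>?H\<^esub> j)"
      using N_eq inj by (simp_all add: pow_H zH)
    have "rcosets\<^bsub>?H\<^esub> N \<subseteq> (\<lambda>x. N #>\<^bsub>GL\<^esub> x) ` M"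
      using HsubM by (auto simp: RCOSETS_def r_coset_def)
    then show "finite (rcosets\<^bsub>?H\<^esub> N)"
      using fin finite_subset by blast
  qed (use zH Hz in auto)
  have zinv: "invertible z"
    using z by (simp add: carrier_GL)
  obtain D where D: "mpow D k = z" and Dcomm: "\<And>B. z ** B = B ** z \<Longrightarrow> D ** B = B ** D"
    using invertible_kth_root[OF zinv k] by blast
  have Dc: "D \<in> carrier GL"
    using mpow_invertible_imp[of D k] D z k by (simp add: carrier_GL)
  have Dpow: "D [^]\<^bsub>GL\<^esub> (int k) = z"
    using D by (simp add: mpow_eq_nat_pow[OF Dc] int_pow_int)
  have DH: "D [^]\<^bsub>GL\<^esub> (i::int) \<otimes>\<^bsub>GL\<^esub> x = x \<otimes>\<^bsub>GL\<^esub> D [^]\<^bsub>GL\<^esub> i" if "x \<in> H" for i x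
    using Dcomm[of x] Hz[OF that]
    by (intro GL.int_pow_commute Dc Hc that) (simp add: mult_GL)
  \<comment> \<open>From \<open>V z = int k\<close> and \<open>mpow D k = z\<close> it follows that
    \<open>\<rho>\<close> sends \<open>z\<close> to 1; it is multiplicative because \<open>D\<close>
    commutes with \<open>H\<close>.\<close>
  define \<rho> where "\<rho> x = x \<otimes>\<^bsub>GL\<^esub> D [^]\<^bsub>GL\<^esub> (- V x)" for x
  have \<rho>_mult: "\<rho> (x \<otimes>\<^bsub>GL\<^esub> y) = \<rho> x \<otimes>\<^bsub>GL\<^esub> \<rho> y"
    and \<rho>_mult': "\<rho> x \<otimes>\<^bsub>GL\<^esub> \<rho> y = (x \<otimes>\<^bsub>GL\<^esub> y) \<otimes>\<^bsub>GL\<^esub> D [^]\<^bsub>GL\<^esub> (- V x - V y)"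
    if xy: "x \<in> H" "y \<in> H" for x y
  proof -
    have c: "x \<in> carrier GL" "y \<in> carrier GL" using xy Hc by auto
    have "\<rho> x \<otimes>\<^bsub>GL\<^esub> \<rho> y = x \<otimes>\<^bsub>GL\<^esub> (D [^]\<^bsub>GL\<^esub> (- V x) \<otimes>\<^bsub>GL\<^esub> y) \<otimes>\<^bsub>GL\<^esub> D [^]\<^bsub>GL\<^esub> (- V y)"
      using c Dc by (simp add: \<rho>_def GL.m_assoc)
    also have "\<dots> = (x \<otimes>\<^bsub>GL\<^esub> y) \<otimes>\<^bsub>GL\<^esub> (D [^]\<^bsub>GL\<^esub> (- V x) \<otimes>\<^bsub>GL\<^esub> D [^]\<^bsub>GL\<^esub> (- V y))"
      unfolding DH[OF xy(2)] using c Dc by (simp add: GL.m_assoc)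
    also have "D [^]\<^bsub>GL\<^esub> (- V x) \<otimes>\<^bsub>GL\<^esub> D [^]\<^bsub>GL\<^esub> (- V y) = D [^]\<^bsub>GL\<^esub> (- V x - V y)"
      using Dc by (simp flip: GL.int_pow_mult)
    finally show *: "\<rho> x \<otimes>\<^bsub>GL\<^esub> \<rho> y = (x \<otimes>\<^bsub>GL\<^esub> y) \<otimes>\<^bsub>GL\<^esub> D [^]\<^bsub>GL\<^esub> (- V x - V y)" .
    then show "\<rho> (x \<otimes>\<^bsub>GL\<^esub> y) = \<rho> x \<otimes>\<^bsub>GL\<^esub> \<rho> y"
      using V[OF xy] by (simp add: \<rho>_def)
  qed
  have \<rho>_reflects: "x \<otimes>\<^bsub>GL\<^esub> y = y \<otimes>\<^bsub>GL\<^esub> x"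
    if xy: "x \<in> H" "y \<in> H" and eq: "\<rho> x \<otimes>\<^bsub>GL\<^esub> \<rho> y = \<rho> y \<otimes>\<^bsub>GL\<^esub> \<rho> x" for x y
  proof -
    \<comment> \<open>The correcting power of \<open>D\<close> is symmetric in \<open>x\<close> and
      \<open>y\<close> and cancels.\<close>
    have "(x \<otimes>\<^bsub>GL\<^esub> y) \<otimes>\<^bsub>GL\<^esub> D [^]\<^bsub>GL\<^esub> (- V x - V y) = (y \<otimes>\<^bsub>GL\<^esub> x) \<otimes>\<^bsub>GL\<^esub> D [^]\<^bsub>GL\<^esub> (- V x - V y)"
      using eq unfolding \<rho>_mult'[OF xy] \<rho>_mult'[OF xy(2,1)] by (simp only: diff_conv_add_uminus add.commute)
    then show ?thesis
      using xy Hc Dc by simp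
  qed
  have \<rho>_closed: "\<rho> x \<in> carrier GL" if "x \<in> H" for x
    using Hc[OF that] Dc by (simp add: \<rho>_def)
  interpret \<rho>: group_hom ?H GL \<rho>
  proof
    show "\<rho> \<in> hom ?H GL"
    proof (rule homI)
      show "\<rho> x \<in> carrier GL" if "x \<in> carrier ?H" for x
        using \<rho>_closed that by simp
      show "\<rho> (x \<otimes>\<^bsub>?H\<^esub> y) = \<rho> x \<otimes>\<^bsub>GL\<^esub> \<rho> y" if "x \<in> carrier ?H" "y \<in> carrier ?H" for x y
        using \<rho>_mult[of x y] that by simp
    qed
  qed
  define R where "R = \<rho> ` H"
  have "\<rho> z = \<one>\<^bsub>GL\<^esub>"
    using Dc z by (simp add: \<rho>_def Vz GL.int_pow_neg Dpow)
  then have \<rho>N: "\<rho> x = \<one>\<^bsub>GL\<^esub>" if x: "x \<in> N" for x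
  proof -
    obtain j :: int where j: "x = z [^]\<^bsub>GL\<^esub> j"
      using x unfolding N_eq by blast
    have "\<rho> (z [^]\<^bsub>?H\<^esub> j) = \<rho> z [^]\<^bsub>GL\<^esub> j"
      by (rule \<rho>.hom_int_pow) (simp add: zH)
    then show ?thesis
      unfolding pow_H[OF zH] j[symmetric] \<open>\<rho> z = \<one>\<^bsub>GL\<^esub>\<close> GL.int_pow_one .
  qed
  have "finite ((\<lambda>x. N #>\<^bsub>GL\<^esub> x) ` H)"
    by (rule finite_subset[OF image_mono[OF HsubM] fin])
  from finite_subset_image[OF this order_refl]
  obtain F where F: "finite F" "F \<subseteq> H" "(\<lambda>x. N #>\<^bsub>GL\<^esub> x) ` H = (\<lambda>x. N #>\<^bsub>GL\<^esub> x) ` F"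
    by blast
  \<comment> \<open>As \<open>\<rho>\<close> kills \<open>N\<close>, it is constant on cosets, so
    representatives of the finitely many cosets exhaust its image.\<close>
  have "R \<subseteq> \<rho> ` F"
  proof
    fix u assume "u \<in> R"
    then obtain x where x: "x \<in> H" "u = \<rho> x" by (auto simp: R_def)
    then obtain y where y: "y \<in> F" "N #>\<^bsub>GL\<^esub> x = N #>\<^bsub>GL\<^esub> y"
      using F(3) by blast
    have yH: "y \<in> H" using y F by blast
    have "x \<in> N #>\<^bsub>GL\<^esub> y"
      unfolding y(2)[symmetric] by (rule GL.rcos_self[OF Hc[OF x(1)] N(1)])
    then obtain w where w: "w \<in> N" "x = w \<otimes>\<^bsub>GL\<^esub> y"
      by (auto simp: r_coset_def)
    have "w \<in> H" using w NH by blast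
    then have "\<rho> x = \<rho> w \<otimes>\<^bsub>GL\<^esub> \<rho> y"
      unfolding w(2) using yH by (rule \<rho>_mult)
    then have "\<rho> x = \<rho> y"
      by (simp add: \<rho>N[OF w(1)] \<rho>_closed[OF yH])
    then have "u = \<rho> y" by (simp only: x(2))
    then show "u \<in> \<rho> ` F" using y(1) by (rule image_eqI)
  qed
  then have "finite R"
    using F(1) finite_surj by blast
  moreover have "subgroup R GL"
    using \<rho>.img_is_subgroup by (simp add: R_def)
  ultimately interpret R: finite_linear_group R
    by (rule finite_linear_group.intro)
  define S where "S = {x \<in> H. op_bound R (\<rho> x - mat 1) (1/4)}"
  have S_comm: "x \<otimes>\<^bsub>GL\<^esub> y = y \<otimes>\<^bsub>GL\<^esub> x" if "x \<in> S" "y \<in> S" for x y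
  proof -
    have xy: "x \<in> H" "y \<in> H"
      using that by (simp_all add: S_def)
    have r: "\<rho> x \<in> R" "\<rho> y \<in> R"
      unfolding R_def by (rule imageI[OF xy(1)], rule imageI[OF xy(2)])
    have b: "op_bound R (\<rho> x - mat 1) (1/4)" "op_bound R (\<rho> y - mat 1) (1/4)"
      using that by (simp_all add: S_def)
    have "\<rho> x ** \<rho> y = \<rho> y ** \<rho> x"
      by (rule R.near_one_commute[OF r(1) b(1) r(2) b(2)])
    then show ?thesis
      unfolding mult_GL[symmetric] by (rule \<rho>_reflects[OF xy])
  qed
  \<comment> \<open>\<open>S\<close> need not be a subgroup. Its elements commute pairwise, so it
    lies in its centralizer \<open>Z\<close>; the centralizer \<open>A\<close> of \<open>Z\<close>
    then contains \<open>S\<close>, and it lies in \<open>Z\<close> because \<open>Z\<close>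
    contains \<open>S\<close>. Hence \<open>A\<close> is abelian.\<close>
  define Z where "Z = {h \<in> H. \<forall>x\<in>S. h \<otimes>\<^bsub>GL\<^esub> x = x \<otimes>\<^bsub>GL\<^esub> h}"
  define A where "A = {h \<in> H. \<forall>x\<in>Z. h \<otimes>\<^bsub>GL\<^esub> x = x \<otimes>\<^bsub>GL\<^esub> h}"
  have ZH: "Z \<subseteq> carrier GL" using Hc by (auto simp: Z_def)
  have SZ: "S \<subseteq> Z"
  proof
    fix x assume x: "x \<in> S"
    then have "x \<in> H" by (simp add: S_def)
    moreover have "\<forall>y\<in>S. x \<otimes>\<^bsub>GL\<^esub> y = y \<otimes>\<^bsub>GL\<^esub> x"
      using S_comm[OF x] by blast
    ultimately show "x \<in> Z" unfolding Z_def by blast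
  qed
  have SA: "S \<subseteq> A"
  proof
    fix x assume x: "x \<in> S"
    then have "x \<in> H" by (simp add: S_def)
    moreover have "\<forall>h\<in>Z. x \<otimes>\<^bsub>GL\<^esub> h = h \<otimes>\<^bsub>GL\<^esub> x"
    proof
      fix h assume "h \<in> Z"
      then have "h \<otimes>\<^bsub>GL\<^esub> x = x \<otimes>\<^bsub>GL\<^esub> h"
        using x unfolding Z_def by blast
      then show "x \<otimes>\<^bsub>GL\<^esub> h = h \<otimes>\<^bsub>GL\<^esub> x" by (rule sym)
    qed
    ultimately show "x \<in> A" unfolding A_def by blast
  qed
  have AZ: "A \<subseteq> Z"
  proof
    fix x assume x: "x \<in> A"
    then have "x \<in> H" "\<forall>h\<in>Z. x \<otimes>\<^bsub>GL\<^esub> h = h \<otimes>\<^bsub>GL\<^esub> x"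
      unfolding A_def by blast+
    moreover from this(2) SZ have "\<forall>h\<in>S. x \<otimes>\<^bsub>GL\<^esub> h = h \<otimes>\<^bsub>GL\<^esub> x"
      by blast
    ultimately show "x \<in> Z"
      unfolding Z_def by blast
  qed
  have pair: "\<exists>x\<in>T. \<exists>y\<in>T. x \<noteq> y \<and> x \<otimes>\<^bsub>GL\<^esub> inv\<^bsub>GL\<^esub> y \<in> A"
    if T: "T \<subseteq> M" "card T > ?n" and TH: "\<And>x y. x \<in> T \<Longrightarrow> y \<in> T \<Longrightarrow> x \<otimes>\<^bsub>GL\<^esub> inv\<^bsub>GL\<^esub> y \<in> H" for T
  proof -
    obtain t where t: "t \<in> T"
      using T(2) by (metis card.empty not_less_zero ex_in_conv)
    have Tc: "x \<in> carrier GL" if "x \<in> T" for x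
      using that T subgroup.subset[OF M] by blast
    \<comment> \<open>\<open>T\<close> itself may lie outside \<open>H\<close>; dividing by a fixed
      \<open>t\<close> moves it into \<open>H\<close>, where \<open>\<rho>\<close> is a
      homomorphism.\<close>
    let ?F = "\<lambda>x. \<rho> (x \<otimes>\<^bsub>GL\<^esub> inv\<^bsub>GL\<^esub> t)"
    have FR: "?F x \<in> R" if "x \<in> T" for x
      unfolding R_def by (rule imageI[OF TH[OF that t]])
    have "\<exists>x\<in>T. \<exists>y\<in>T. x \<noteq> y \<and> op_bound R (?F x - ?F y) (1/4)"
    proof (cases "inj_on ?F T")
      case True
      have gt: "card (?F ` T) > ?n"
        using T(2) by (simp only: card_image[OF True])
      show ?thesis
      proof (rule ccontr)
        assume none: "\<not> ?thesis"
        have "card (?F ` T) \<le> ?n"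
        proof (rule R.separated_elements_card_le)
          show "?F ` T \<subseteq> R" using FR by blast
          show "\<not> op_bound R (u - v) (1/4)" if "u \<in> ?F ` T" "v \<in> ?F ` T" "u \<noteq> v" for u v
          proof -
            obtain x y where "x \<in> T" "y \<in> T" "u = ?F x" "v = ?F y"
              using \<open>u \<in> ?F ` T\<close> \<open>v \<in> ?F ` T\<close> by (elim imageE)
            with none \<open>u \<noteq> v\<close> show ?thesis by metis
          qed
        qed
        with gt show False by (meson leD)
      qed
    next
      case False
      then obtain x y where "x \<in> T" "y \<in> T" "x \<noteq> y" "?F x = ?F y"
        unfolding inj_on_def by blast
      moreover have "op_bound R 0 (1/4)"
        by (simp add: op_bound_def orbit_norm_def sum_nonneg)
      ultimately have "op_bound R (?F x - ?F y) (1/4)"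
        by (simp only: diff_self)
      with \<open>x \<in> T\<close> \<open>y \<in> T\<close> \<open>x \<noteq> y\<close> show ?thesis by blast
    qed
    then obtain x y where xy: "x \<in> T" "y \<in> T" "x \<noteq> y" and b: "op_bound R (?F x - ?F y) (1/4)"
      by blast
    let ?w = "x \<otimes>\<^bsub>GL\<^esub> inv\<^bsub>GL\<^esub> y"
    have "inv\<^bsub>GL\<^esub> y \<otimes>\<^bsub>GL\<^esub> (y \<otimes>\<^bsub>GL\<^esub> inv\<^bsub>GL\<^esub> t) = inv\<^bsub>GL\<^esub> t"
      using Tc[OF xy(2)] Tc[OF t] by (simp add: GL.m_assoc[symmetric])
    then have eq: "x \<otimes>\<^bsub>GL\<^esub> inv\<^bsub>GL\<^esub> t = ?w \<otimes>\<^bsub>GL\<^esub> (y \<otimes>\<^bsub>GL\<^esub> inv\<^bsub>GL\<^esub> t)"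
      using Tc[OF xy(1)] Tc[OF xy(2)] Tc[OF t] by (simp add: GL.m_assoc)
    have "?F x = \<rho> ?w ** ?F y"
      unfolding eq mult_GL[symmetric] by (rule \<rho>_mult[OF TH[OF xy(1,2)] TH[OF xy(2) t]])
    \<comment> \<open>The right factor lies in \<open>R\<close> and so leaves operator bounds
      unchanged: closeness of the two images becomes closeness of \<open>\<rho> ?w\<close> to
      1.\<close>
    then have "?F x - ?F y = (\<rho> ?w - mat 1) ** ?F y"
      unfolding matrix_mul_diff_left by simp
    with b have "op_bound R ((\<rho> ?w - mat 1) ** ?F y) (1/4)"
      by (simp only:)
    then have "op_bound R (\<rho> ?w - mat 1) (1/4)"
      by (simp only: R.op_bound_mult_right[OF FR[OF xy(2)]])
    then have "?w \<in> S"
      using TH[OF xy(1,2)] by (simp add: S_def)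
    with xy SA show ?thesis by blast
  qed
  show ?thesis
  proof (intro exI[of _ A] conjI ballI allI impI)
    show "subgroup A GL"
      unfolding A_def by (rule GL.subgroup_centralizer[OF H ZH])
    show "A \<subseteq> M" by (auto simp: A_def H_def)
    show "x ** y = y ** x" if "x \<in> A" "y \<in> A" for x y
    proof -
      have "x \<otimes>\<^bsub>GL\<^esub> y = y \<otimes>\<^bsub>GL\<^esub> x"
        using that AZ unfolding A_def by blast
      then show ?thesis by (simp only: mult_GL)
    qed
    fix T assume T: "T \<subseteq> M" "card T > 2 * ?n"
    then have finT: "finite T" by (metis card.infinite not_less_zero)
    \<comment> \<open>One of the two parts has more than \<open>?n\<close> elements. In either part
      all quotients lie in \<open>H\<close>, for \<open>T - H\<close> because conjugation by each of
      its elements inverts \<open>z\<close>.\<close>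
    have "card T = card (T \<inter> H) + card (T - H)"
      using card_Un_disjoint[of "T \<inter> H" "T - H"] finT by (simp add: Int_Diff_Un Int_Diff_disjoint)
    then consider "card (T \<inter> H) > ?n" | "card (T - H) > ?n"
      using T by linarith
    then show "\<exists>x\<in>T. \<exists>y\<in>T. x \<noteq> y \<and> x \<otimes>\<^bsub>GL\<^esub> inv\<^bsub>GL\<^esub> y \<in> A"
    proof cases
      case 1
      have *: "x \<otimes>\<^bsub>GL\<^esub> inv\<^bsub>GL\<^esub> y \<in> H" if "x \<in> T \<inter> H" "y \<in> T \<inter> H" for x y
        using that by (intro subgroup.m_closed[OF H] subgroup.m_inv_closed[OF H]) simp_all
      have "T \<inter> H \<subseteq> M" using T by blast
      from pair[OF this 1 *] show ?thesis by blast
    next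
      case 2
      have *: "x \<otimes>\<^bsub>GL\<^esub> inv\<^bsub>GL\<^esub> y \<in> H" if "x \<in> T - H" "y \<in> T - H" for x y
      proof -
        have xy: "x \<in> M" "y \<in> M" "x \<otimes>\<^bsub>GL\<^esub> z \<noteq> z \<otimes>\<^bsub>GL\<^esub> x" "y \<otimes>\<^bsub>GL\<^esub> z \<noteq> z \<otimes>\<^bsub>GL\<^esub> y"
          using that T by (auto simp: H_def)
        have "(x \<otimes>\<^bsub>GL\<^esub> inv\<^bsub>GL\<^esub> y) \<otimes>\<^bsub>GL\<^esub> z = z \<otimes>\<^bsub>GL\<^esub> (x \<otimes>\<^bsub>GL\<^esub> inv\<^bsub>GL\<^esub> y)"
          by (rule GL.centralizer_index_le_2[OF z inj M _ xy]) (unfold N_eq[symmetric], rule bspec[OF norm])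
        moreover have "x \<otimes>\<^bsub>GL\<^esub> inv\<^bsub>GL\<^esub> y \<in> M"
          using xy by (intro subgroup.m_closed[OF M] subgroup.m_inv_closed[OF M])
        ultimately show ?thesis by (simp add: H_def)
      qed
      have "T - H \<subseteq> M" using T by blast
      from pair[OF this 2 *] show ?thesis by blast
    qed
  qed
qed

theorem theorem3p5:
  "\<exists>C::nat. \<forall>(M :: (complex^'n^'n) set) \<Gamma>.
     subgroup M GL \<longrightarrow>
     normal \<Gamma> (GL\<lparr>carrier := M\<rparr>) \<longrightarrow>
     finite (rcosets\<^bsub>GL\<lparr>carrier := M\<rparr>\<^esub> \<Gamma>) \<longrightarrow>
     (GL\<lparr>carrier := \<Gamma>\<rparr>) \<cong> integer_group \<longrightarrow>
     min_abelian_index ((GL\<lparr>carrier := M\<rparr>) Mod \<Gamma>) < C"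
proof (rule exI[of _ "2 * 9 ^ DIM(complex^'n^'n) + 1"], intro allI impI)
  fix M \<Gamma> :: "(complex^'n^'n) set"
  assume M: "subgroup M GL" and \<Gamma>: "normal \<Gamma> (GL\<lparr>carrier := M\<rparr>)"
    and fin: "finite (rcosets\<^bsub>GL\<lparr>carrier := M\<rparr>\<^esub> \<Gamma>)"
    and iso: "(GL\<lparr>carrier := \<Gamma>\<rparr>) \<cong> integer_group"
  let ?M = "GL\<lparr>carrier := M\<rparr>"
  interpret M: group ?M
    by (rule GL.subgroup_imp_group[OF M])
  have \<Gamma>sub: "subgroup \<Gamma> ?M"
    using \<Gamma> by (rule normal_imp_subgroup)
  have \<Gamma>M: "\<Gamma> \<subseteq> M"
    using subgroup.subset[OF \<Gamma>sub] by simp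
  have \<Gamma>GL: "subgroup \<Gamma> GL"
    using GL.incl_subgroup[OF M \<Gamma>sub] .
  interpret \<Gamma>: group "GL\<lparr>carrier := \<Gamma>\<rparr>"
    by (rule GL.subgroup_imp_group[OF \<Gamma>GL])
  \<comment> \<open>Reversing the isomorphism makes \<open>f 1\<close> a generator and
    \<open>f\<close> its exponent map, so bijectivity gives both \<open>range\<close> and
    \<open>inj\<close>.\<close>
  obtain f where "f \<in> iso integer_group (GL\<lparr>carrier := \<Gamma>\<rparr>)"
    using \<Gamma>.iso_sym[OF iso] by (auto simp: is_iso_def)
  then have f: "f \<in> hom integer_group (GL\<lparr>carrier := \<Gamma>\<rparr>)" "bij_betw f UNIV \<Gamma>"
    by (auto simp: iso_def)
  define z where "z = f 1"
  have z\<Gamma>: "z \<in> \<Gamma>"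
    using f(2) by (auto simp: z_def bij_betw_def)
  have fpow: "f j = z [^]\<^bsub>GL\<^esub> j" for j
  proof -
    interpret f: group_hom integer_group "GL\<lparr>carrier := \<Gamma>\<rparr>" f
      using f(1) \<Gamma>.group_axioms group_integer_group by (intro group_hom.intro group_hom_axioms.intro)
    have "f (1 [^]\<^bsub>integer_group\<^esub> j) = z [^]\<^bsub>GL\<lparr>carrier := \<Gamma>\<rparr>\<^esub> j"
      unfolding z_def by (rule f.hom_int_pow) simp
    then show ?thesis
      using GL.int_pow_consistent[OF \<Gamma>GL z\<Gamma>] by simp
  qed
  have f_eq: "f = (\<lambda>j. z [^]\<^bsub>GL\<^esub> j)"
    using fpow by (rule ext)
  have range: "\<Gamma> = range (\<lambda>j::int. z [^]\<^bsub>GL\<^esub> j)"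
    using bij_betw_imp_surj_on[OF f(2)] unfolding f_eq by (rule sym)
  have inj: "inj (\<lambda>j::int. z [^]\<^bsub>GL\<^esub> j)"
    using bij_betw_imp_inj_on[OF f(2)] unfolding f_eq .
  have zM: "z \<in> M"
    using z\<Gamma> \<Gamma>M by (rule rev_subsetD)
  have norm: "\<forall>m\<in>M. m \<otimes>\<^bsub>GL\<^esub> z \<otimes>\<^bsub>GL\<^esub> inv\<^bsub>GL\<^esub> m \<in> \<Gamma>"
  proof
    fix m assume m: "m \<in> M"
    have "m \<otimes>\<^bsub>?M\<^esub> z \<otimes>\<^bsub>?M\<^esub> inv\<^bsub>?M\<^esub> m \<in> \<Gamma>"
      by (rule normal.inv_op_closed2[OF \<Gamma> _ z\<Gamma>]) (simp add: m)
    then show "m \<otimes>\<^bsub>GL\<^esub> z \<otimes>\<^bsub>GL\<^esub> inv\<^bsub>GL\<^esub> m \<in> \<Gamma>"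
      by (simp add: GL.m_inv_consistent[OF M m])
  qed
  have "(\<lambda>x. \<Gamma> #>\<^bsub>GL\<^esub> x) ` M \<subseteq> rcosets\<^bsub>?M\<^esub> \<Gamma>"
    by (auto simp: RCOSETS_def r_coset_def)
  then have fin': "finite ((\<lambda>x. \<Gamma> #>\<^bsub>GL\<^esub> x) ` M)"
    using fin finite_subset by blast
  from virtually_cyclic_abelian_subgroup[OF M \<Gamma>GL \<Gamma>M range inj zM norm fin']
  obtain A where A: "subgroup A GL" "A \<subseteq> M" "\<forall>x\<in>A. \<forall>y\<in>A. x ** y = y ** x"
    and pairs: "\<forall>T. T \<subseteq> M \<longrightarrow> card T > 2 * 9 ^ DIM(complex^'n^'n) \<longrightarrow>
      (\<exists>x\<in>T. \<exists>y\<in>T. x \<noteq> y \<and> x \<otimes>\<^bsub>GL\<^esub> inv\<^bsub>GL\<^esub> y \<in> A)"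
    by (elim exE conjE) (rule that)
  have "min_abelian_index (?M Mod \<Gamma>) \<le> 2 * 9 ^ DIM(complex^'n^'n)"
  proof (rule M.min_abelian_index_Mod_le[OF \<Gamma>])
    show "subgroup A ?M"
      using GL.subgroup_incl[OF A(1) M A(2)] .
    show "x \<otimes>\<^bsub>?M\<^esub> y = y \<otimes>\<^bsub>?M\<^esub> x" if "x \<in> A" "y \<in> A" for x y
    proof -
      have "x ** y = y ** x" using A(3) that by blast
      then show ?thesis by (simp add: mult_GL)
    qed
    fix T assume T: "T \<subseteq> carrier ?M" "card T > 2 * 9 ^ DIM(complex^'n^'n)"
    have TM: "T \<subseteq> M"
      using T(1) by simp
    from pairs[rule_format, OF TM T(2)]
    obtain x y where xy: "x \<in> T" "y \<in> T" "x \<noteq> y" "x \<otimes>\<^bsub>GL\<^esub> inv\<^bsub>GL\<^esub> y \<in> A"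
      by blast
    have "inv\<^bsub>?M\<^esub> y = inv\<^bsub>GL\<^esub> y"
      using xy(2) TM by (intro GL.m_inv_consistent[OF M]) blast
    with xy(4) have "x \<otimes>\<^bsub>?M\<^esub> inv\<^bsub>?M\<^esub> y \<in> A"
      by simp
    with xy(1-3) show "\<exists>x\<in>T. \<exists>y\<in>T. x \<noteq> y \<and> x \<otimes>\<^bsub>?M\<^esub> inv\<^bsub>?M\<^esub> y \<in> A"
      by blast
  qed
  then show "min_abelian_index (?M Mod \<Gamma>) < 2 * 9 ^ DIM(complex^'n^'n) + 1"
    by simp
qed

end
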